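(* Let $\lambda=(\lambda_n)_{n\in\mathbb{N}}\in c_0$ have infinite range. Let $G:\mathcal{L}_{T_\lambda}\to C(\sigma(T_\lambda))$ be the Gelfand transformation, i.e. the continuous extension to $\mathcal{L}_{T_\lambda}$ of the map defined on polynomials $H=\alpha_0Id+\sum_{m=1}^k\alpha_mT_\lambda^m$ by $H\mapsto G_H$, $G_H(z)=\alpha_0+\sum_{m=1}^k\alpha_mz^m$ for $z\in\sigma(T_\lambda)$. Then $G$ is an isometric isomorphism of algebras from $\mathcal{L}_{T_\lambda}$ (with the operator norm) onto $C(\sigma(T_\lambda))$ (with the supremum norm).
   Context: $\mathbb{K}$ is a complete non-archimedean valued field whose residue class field is formally real. $c_0$ is the Banach space of sequences $x=(x_n)_{n\in\mathbb{N}}$ in $\mathbb{K}$ with $x_n\to 0$, with norm $\|x\|_\infty=\sup_n|x_n|$ and bilinear form $\langle x,y\rangle=\sum_n x_ny_n$; one has $\|x\|_\infty=\sqrt{|\langle x,x\rangle|}$. $Y=\{y^{(i)}\}_{i\in\mathbb{N}}$ is a fixed orthonormal sequence in $c_0$: $\langle y^{(i)},y^{(j)}\rangle=0$ for $i\ne j$ and $\|y^{(i)}\|_\infty=1$. Put $P_i(x)=\frac{\langle x,y^{(i)}\rangle}{\langle y^{(i)},y^{(i)}\rangle}y^{(i)}$. For $\lambda=(\lambda_i)\in c_0$ let $T_\lambda=\sum_{i=1}^\infty\lambda_iP_i$. $\mathcal{S}_Y(c_0)=\{\alpha Id+T_\mu:\alpha\in\mathbb{K},\mu\in c_0\}$ with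 operator norm and composition. $\mathcal{L}_{T_\lambda}$ is the closure in $\mathcal{S}_Y(c_0)$, for the operator norm, of the algebra of polynomials in $T_\lambda$ with coefficients in $\mathbb{K}$ (including constants times the identity $Id$). $\sigma(T_\lambda)=\{\lambda_n:n\in\mathbb{N}\}\cup\{0\}$, with the topology induced by $\mathbb{K}$ (it is compact). $C(\sigma(T_\lambda))$ is the algebra of continuous functions $\sigma(T_\lambda)\to\mathbb{K}$ with pointwise operations and the supremum norm. *)

theory Defs
  imports
    "HOL-Analysis.Analysis"
    "HOL-Computational_Algebra.Polynomial"
    "HOL-Algebra.QuotRing"
    "HOL-Algebra.Module"
begin

text \<open>
  Non-negativity and definiteness of the valuation follow from the compatibility of \<open>val\<close> with the
  metric, through which the library's notions of limit, series and continuity refer to \<open>val\<close>.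
  The library constant \<^const>\<open>norm\<close> is reserved for real normed vector spaces. The trivial
  valuation is not excluded.
\<close>

class complete_nonarch_field = field + complete_space +
  fixes val :: "'a \<Rightarrow> real"
  assumes dist_val: "dist x y = val (x - y)"
    and val_mult: "val (x * y) = val x * val y"
    and val_add_le_max: "val (x + y) \<le> max (val x) (val y)"

context complete_nonarch_field
begin

lemma val_eq_dist: "val x = dist x 0"
  by (simp add: dist_val)

lemma val_nonneg: "0 \<le> val x"
  by (simp add: val_eq_dist)

lemma val_eq_0_iff: "val x = 0 \<longleftrightarrow> x = 0"
  by (simp add: val_eq_dist)

lemma val_minus: "val (- x) = val x"
  using dist_commute[of x 0] by (simp add: dist_val)

end

definition valuation_ring :: "'k::complete_nonarch_field ring" where
  "valuation_ring = \<lparr>carrier = {a. val a \<le> 1}, mult = (*), one = 1, zero = 0, add = (+)\<rparr>"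

definition residue_class_field :: "'k::complete_nonarch_field set ring" where
  "residue_class_field = valuation_ring Quot {a. val a < 1}"

locale formally_real_field = field F for F (structure) +
  assumes sum_squares_eq_zeroD:
    "\<lbrakk>a \<in> {..<n::nat} \<rightarrow> carrier F; (\<Oplus>i\<in>{..<n}. a i \<otimes> a i) = \<zero>; i < n\<rbrakk> \<Longrightarrow> a i = \<zero>"

typedef (overloaded) 'k c0 = "{x :: nat \<Rightarrow> 'k::complete_nonarch_field. x \<longlonglongrightarrow> 0}"
  morphisms c0_nth Abs_c0
  by (rule exI[of _ "\<lambda>_. 0"]) simp

setup_lifting type_definition_c0

lemma tendsto_0_iff_val:
  "(x \<longlonglongrightarrow> (0::'k::complete_nonarch_field)) \<longleftrightarrow> (\<lambda>n. val (x n)) \<longlonglongrightarrow> 0"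
  using tendsto_dist_iff[of x 0 sequentially] by (simp add: val_eq_dist)

lemma null_seq_add:
  assumes "x \<longlonglongrightarrow> (0::'k::complete_nonarch_field)" "y \<longlonglongrightarrow> 0"
  shows "(\<lambda>n. x n + y n) \<longlonglongrightarrow> 0"
proof -
  have "(\<lambda>n. max (val (x n)) (val (y n))) \<longlonglongrightarrow> max 0 0"
    using assms by (intro tendsto_max) (simp_all add: tendsto_0_iff_val)
  then have lim: "(\<lambda>n. max (val (x n)) (val (y n))) \<longlonglongrightarrow> 0" by simp
  have "(\<lambda>n. val (x n + y n)) \<longlonglongrightarrow> 0"
    by (rule tendsto_sandwich[OF _ _ tendsto_const lim]) (simp_all add: val_nonneg val_add_le_max)
  then show ?thesis by (simp add: tendsto_0_iff_val)
qed

lemma null_seq_minus: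
  "x \<longlonglongrightarrow> (0::'k::complete_nonarch_field) \<Longrightarrow> (\<lambda>n. - x n) \<longlonglongrightarrow> 0"
  by (simp add: tendsto_0_iff_val val_minus)

lemma null_seq_scale:
  "x \<longlonglongrightarrow> (0::'k::complete_nonarch_field) \<Longrightarrow> (\<lambda>n. a * x n) \<longlonglongrightarrow> 0"
  using tendsto_mult_left[of "\<lambda>n. val (x n)" 0 sequentially "val a"]
  by (simp add: tendsto_0_iff_val val_mult)

instantiation c0 :: (complete_nonarch_field) ab_group_add
begin

lift_definition zero_c0 :: "'a c0" is "\<lambda>_. 0" by simp
lift_definition plus_c0 :: "'a c0 \<Rightarrow> 'a c0 \<Rightarrow> 'a c0" is "\<lambda>x y n. x n + y n"
  by (rule null_seq_add)
lift_definition uminus_c0 :: "'a c0 \<Rightarrow> 'a c0" is "\<lambda>x n. - x n"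
  by (rule null_seq_minus)
definition minus_c0 :: "'a c0 \<Rightarrow> 'a c0 \<Rightarrow> 'a c0" where "minus_c0 x y = x + (- y)"

instance
  by standard (unfold minus_c0_def, (transfer; simp add: algebra_simps fun_eq_iff)+)

end

lift_definition scale_c0 :: "'k::complete_nonarch_field \<Rightarrow> 'k c0 \<Rightarrow> 'k c0" (infixr "*\<^sub>c" 75)
  is "\<lambda>a x n. a * x n"
  by (rule null_seq_scale)

definition norm_c0 :: "'k::complete_nonarch_field c0 \<Rightarrow> real" where
  "norm_c0 x = (SUP n. val (c0_nth x n))"
lemma c0_bdd_above: "bdd_above (range (\<lambda>n. val (c0_nth x n)))"
proof -
  have "(\<lambda>n. val (c0_nth x n)) \<longlonglongrightarrow> 0"
    using c0_nth[of x] by (simp add: tendsto_0_iff_val)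
  then have "Bseq (\<lambda>n. val (c0_nth x n))"
    by (intro convergent_imp_Bseq) (auto simp: convergent_def)
  then show ?thesis by (simp add: Bseq_eq_bounded bounded_imp_bdd_above)
qed

lemma c0_val_le_norm: "val (c0_nth x n) \<le> norm_c0 x"
  unfolding norm_c0_def by (rule cSUP_upper[OF _ c0_bdd_above]) simp

lemma c0_norm_leI: "(\<And>n. val (c0_nth x n) \<le> r) \<Longrightarrow> norm_c0 x \<le> r"
  unfolding norm_c0_def by (rule cSUP_least) auto

lemma c0_norm_eq_0_iff: "norm_c0 x = 0 \<longleftrightarrow> x = 0" for x :: "'k::complete_nonarch_field c0"
proof
  assume "norm_c0 x = 0"
  then have "val (c0_nth x n) = 0" for n
    using c0_val_le_norm[of x n] val_nonneg[of "c0_nth x n"] by simp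
  then show "x = 0" by transfer (auto simp: val_eq_0_iff)
next
  assume "x = 0"
  then have "c0_nth x n = 0" for n by (simp add: zero_c0.rep_eq)
  then show "norm_c0 x = 0" by (simp add: norm_c0_def val_eq_0_iff)
qed

lemma c0_norm_minus: "norm_c0 (- x) = norm_c0 x" for x :: "'k::complete_nonarch_field c0"
  by (simp add: norm_c0_def uminus_c0.rep_eq val_minus)

lemma c0_norm_add_le_max: "norm_c0 (x + y) \<le> max (norm_c0 x) (norm_c0 y)"
  for x :: "'k::complete_nonarch_field c0"
proof (rule c0_norm_leI)
  fix n
  show "val (c0_nth (x + y) n) \<le> max (norm_c0 x) (norm_c0 y)"
    using val_add_le_max[of "c0_nth x n" "c0_nth y n"] c0_val_le_norm[of x n] c0_val_le_norm[of y n]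
    by (simp add: plus_c0.rep_eq)
qed

lemma c0_norm_nonneg: "0 \<le> norm_c0 x" for x :: "'k::complete_nonarch_field c0"
  using c0_val_le_norm[of x 0] val_nonneg[of "c0_nth x 0"] by simp

instantiation c0 :: (complete_nonarch_field) metric_space
begin

definition dist_c0 :: "'a c0 \<Rightarrow> 'a c0 \<Rightarrow> real" where "dist_c0 x y = norm_c0 (x - y)"
definition uniformity_c0 :: "('a c0 \<times> 'a c0) filter"
  where "uniformity_c0 = (INF e\<in>{0<..}. principal {(x, y). dist x y < e})"
definition open_c0 :: "'a c0 set \<Rightarrow> bool"
  where "open_c0 U \<longleftrightarrow> (\<forall>x\<in>U. eventually (\<lambda>(x', y). x' = x \<longrightarrow> y \<in> U) uniformity)"

instance
proof (intro_classes, goal_cases)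
  case 1
  show ?case by (rule uniformity_c0_def)
next
  case (2 U)
  show ?case by (rule open_c0_def)
next
  case (3 x y)
  show ?case by (simp add: dist_c0_def c0_norm_eq_0_iff)
next
  case (4 x y z)
  have eq: "(x - z) + - (y - z) = x - y" by simp
  have "norm_c0 (x - y) \<le> max (norm_c0 (x - z)) (norm_c0 (y - z))"
    using c0_norm_add_le_max[of "x - z" "- (y - z)"] unfolding c0_norm_minus eq .
  then show ?case
    using c0_norm_nonneg[of "x - z"] c0_norm_nonneg[of "y - z"] by (simp add: dist_c0_def)
qed

end

definition form_c0 :: "'k::complete_nonarch_field c0 \<Rightarrow> 'k c0 \<Rightarrow> 'k" where
  "form_c0 x y = (\<Sum>n. c0_nth x n * c0_nth y n)"

definition orthonormal_seq :: "(nat \<Rightarrow> 'k::complete_nonarch_field c0) \<Rightarrow> bool" where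
  "orthonormal_seq Y \<longleftrightarrow>
     (\<forall>i j. i \<noteq> j \<longrightarrow> form_c0 (Y i) (Y j) = 0) \<and> (\<forall>i. norm_c0 (Y i) = 1)"

text \<open>
  Operators without finite norm, and functions that are unbounded on the given set, get norm \<open>0\<close>,
  so that the distances below are non-negative everywhere, as \<^locale>\<open>Metric_space\<close> demands. This
  concerns no element of the spaces considered here.
\<close>

definition op_norm :: "('k::complete_nonarch_field c0 \<Rightarrow> 'k c0) \<Rightarrow> real" where
  "op_norm T = (if bdd_above ((\<lambda>x. norm_c0 (T x) / norm_c0 x) ` (-{0}))
     then SUP x\<in>-{0}. norm_c0 (T x) / norm_c0 x else 0)"

definition op_dist ::
  "('k::complete_nonarch_field c0 \<Rightarrow> 'k c0) \<Rightarrow> ('k c0 \<Rightarrow> 'k c0) \<Rightarrow> real" where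
  "op_dist S T = op_norm (\<lambda>x. S x - T x)"

definition proj_along :: "'k::complete_nonarch_field c0 \<Rightarrow> 'k c0 \<Rightarrow> 'k c0" where
  "proj_along y x = (form_c0 x y / form_c0 y y) *\<^sub>c y"

text \<open>\<open>T\<^sub>\<lambda>\<close> as a pointwise sum, converging in the norm of \<open>c0\<close>.\<close>

definition diag_op ::
  "(nat \<Rightarrow> 'k::complete_nonarch_field c0) \<Rightarrow> 'k c0 \<Rightarrow> 'k c0 \<Rightarrow> 'k c0" where
  "diag_op Y l x = (\<Sum>i. c0_nth l i *\<^sub>c proj_along (Y i) x)"

definition S_alg :: "(nat \<Rightarrow> 'k::complete_nonarch_field c0) \<Rightarrow> ('k c0 \<Rightarrow> 'k c0) set" where
  "S_alg Y = {\<lambda>x. a *\<^sub>c x + diag_op Y m x | a m. True}"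

definition poly_op ::
  "'k::complete_nonarch_field poly \<Rightarrow> ('k c0 \<Rightarrow> 'k c0) \<Rightarrow> 'k c0 \<Rightarrow> 'k c0" where
  "poly_op p T x = (\<Sum>m\<le>degree p. coeff p m *\<^sub>c (T ^^ m) x)"

definition L_alg ::
  "(nat \<Rightarrow> 'k::complete_nonarch_field c0) \<Rightarrow> 'k c0 \<Rightarrow> ('k c0 \<Rightarrow> 'k c0) set" where
  "L_alg Y l =
     Metric_space.mtopology (S_alg Y) op_dist closure_of range (\<lambda>p. poly_op p (diag_op Y l))"

definition op_algebra ::
  "('k::complete_nonarch_field c0 \<Rightarrow> 'k c0) set \<Rightarrow> ('k, 'k c0 \<Rightarrow> 'k c0) module" where
  "op_algebra A = \<lparr>carrier = A, mult = (\<lambda>S T. S \<circ> T), one = id, zero = (\<lambda>x. 0),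
     add = (\<lambda>S T x. S x + T x), smult = (\<lambda>a T x. a *\<^sub>c T x)\<rparr>"

definition spec :: "'k::complete_nonarch_field c0 \<Rightarrow> 'k set" where
  "spec l = range (c0_nth l) \<union> {0}"

text \<open>
  Functions on \<open>K\<close> are represented by extensional functions, so that equality in the carrier is
  equality on \<open>K\<close>.
\<close>

definition cont_funs :: "'k::complete_nonarch_field set \<Rightarrow> ('k \<Rightarrow> 'k) set" where
  "cont_funs K = {f \<in> extensional K. continuous_on K f}"

definition sup_norm :: "'k::complete_nonarch_field set \<Rightarrow> ('k \<Rightarrow> 'k) \<Rightarrow> real" where
  "sup_norm K f = (if bdd_above ((\<lambda>z. val (f z)) ` K) then SUP z\<in>K. val (f z) else 0)"

definition sup_dist :: "'k::complete_nonarch_field set \<Rightarrow> ('k \<Rightarrow> 'k) \<Rightarrow> ('k \<Rightarrow> 'k) \<Rightarrow> real" where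
  "sup_dist K f g = sup_norm K (\<lambda>z. f z - g z)"

definition cont_algebra :: "'k::complete_nonarch_field set \<Rightarrow> ('k, 'k \<Rightarrow> 'k) module" where
  "cont_algebra K = \<lparr>carrier = cont_funs K, mult = (\<lambda>f g. \<lambda>z\<in>K. f z * g z),
     one = (\<lambda>z\<in>K. 1), zero = (\<lambda>z\<in>K. 0), add = (\<lambda>f g. \<lambda>z\<in>K. f z + g z),
     smult = (\<lambda>a f. \<lambda>z\<in>K. a * f z)\<rparr>"

definition gelfand_transformation ::
  "(nat \<Rightarrow> 'k::complete_nonarch_field c0) \<Rightarrow> 'k c0 \<Rightarrow> (('k c0 \<Rightarrow> 'k c0) \<Rightarrow> 'k \<Rightarrow> 'k) \<Rightarrow> bool"
where
  "gelfand_transformation Y l G \<longleftrightarrow>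
     G \<in> extensional (L_alg Y l) \<and>
     continuous_map (Metric_space.mtopology (L_alg Y l) op_dist)
       (Metric_space.mtopology (cont_funs (spec l)) (sup_dist (spec l))) G \<and>
     (\<forall>p. G (poly_op p (diag_op Y l)) = (\<lambda>z\<in>spec l. poly p z))"

definition algebra_iso :: "('k, 'a) module \<Rightarrow> ('k, 'b) module \<Rightarrow> ('a \<Rightarrow> 'b) set" where
  "algebra_iso A B = {h \<in> ring_iso A B.
     \<forall>a. \<forall>x\<in>carrier A. h (a \<odot>\<^bsub>A\<^esub> x) = a \<odot>\<^bsub>B\<^esub> h x}"

end

theory Submission
  imports Defs
begin

text \<open>
  Write an element \<open>\<alpha> Id + T\<^sub>\<mu>\<close> of \<open>S\<^sub>Y(c\<^sub>0)\<close> through its sequence of eigenvalues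
  \<open>m\<^sub>i = \<alpha> + \<mu>\<^sub>i\<close>, which converges to \<open>\<alpha>\<close>. Since the residue class field is formally real, all
  \<open>\<langle>y\<^sup>(\<^sup>i\<^sup>), y\<^sup>(\<^sup>i\<^sup>)\<rangle>\<close> have valuation 1, so the \<open>P\<^sub>i\<close> are contractions; with
  \<open>\<bar>m\<^sub>i - \<alpha>\<bar> \<le> max(\<bar>m\<^sub>i\<bar>, \<bar>\<alpha>\<bar>)\<close> the ultrametric inequality gives operator norm \<open>sup\<^sub>i \<bar>m\<^sub>i\<bar>\<close>.
  Hence \<open>f \<mapsto> f(0) Id + \<Sum>\<^sub>i (f(\<lambda>\<^sub>i) - f(0)) P\<^sub>i\<close> is an isometric algebra homomorphism on the
  continuous functions on the spectrum that sends a polynomial \<open>p\<close> to \<open>p(T\<^sub>\<lambda>)\<close>. Its image is the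
  closure of the polynomials in \<open>T\<^sub>\<lambda>\<close>, because polynomials are uniformly dense on a null
  sequence, and its inverse is the Gelfand transformation.
\<close>

section \<open>Complete ultrametric groups\<close>

text \<open>Common ground of the field and of \<open>c0\<close>, so that series with null terms are
  treated once for both. The distance to 0 stands for \<open>val\<close> and \<open>norm_c0\<close>,
  which are different constants.\<close>

class nonarch_group = ab_group_add + complete_space +
  assumes dist_eq_dist_diff: "dist x y = dist (x - y) 0"
    and dist_add_0_le_max: "dist (x + y) 0 \<le> max (dist x 0) (dist y 0)"

lemma dist_sum_0_le:
  fixes u :: "'i \<Rightarrow> 'a::nonarch_group"
  assumes "\<And>i. i \<in> A \<Longrightarrow> dist (u i) 0 \<le> M" "0 \<le> M"
  shows "dist (\<Sum>i\<in>A. u i) 0 \<le> M"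
  using assms
proof (induction A rule: infinite_finite_induct)
  case (insert i A)
  then show ?case using dist_add_0_le_max[of "u i" "sum u A"] by fastforce
qed auto

text \<open>Opens the library's calculus of limits and series, such as \<open>tendsto_add\<close>,
  \<open>tendsto_diff\<close> and \<open>sums_add\<close>, to the field and to
  \<open>c0\<close>.\<close>

instance nonarch_group \<subseteq> topological_ab_group_add
proof
  fix a b :: 'a
  have le: "dist (x + y) (a + b) \<le> dist x a + dist y b" for x y
  proof -
    have "dist (x + y) (a + b) = dist ((x - a) + (y - b)) 0"
      by (subst dist_eq_dist_diff) (simp add: algebra_simps)
    also have "\<dots> \<le> max (dist (x - a) 0) (dist (y - b) 0)" by (rule dist_add_0_le_max)
    also have "\<dots> \<le> dist x a + dist y b"
      by (simp add: dist_eq_dist_diff[of x a] dist_eq_dist_diff[of y b])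
    finally show ?thesis .
  qed
  have "((\<lambda>x. dist (fst x) a + dist (snd x) b) \<longlongrightarrow> dist a a + dist b b) (nhds a \<times>\<^sub>F nhds b)"
    by (intro tendsto_add tendsto_dist tendsto_const filterlim_fst filterlim_snd)
  then have lim: "((\<lambda>x. dist (fst x) a + dist (snd x) b) \<longlongrightarrow> 0) (nhds a \<times>\<^sub>F nhds b)" by simp
  show "((\<lambda>x. fst x + snd x) \<longlongrightarrow> a + b) (nhds a \<times>\<^sub>F nhds b)"
    unfolding tendsto_dist_iff[of _ "a + b"]
    by (rule tendsto_sandwich[OF _ _ tendsto_const lim]) (simp_all add: le)
  have eq: "dist (- x) (- a) = dist x a" for x
    using dist_eq_dist_diff[of "-x" "-a"] dist_eq_dist_diff[of a x]
    by (simp add: dist_commute)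
  show "(uminus \<longlongrightarrow> - a) (nhds a)"
    using filterlim_ident[of "nhds a"]
    unfolding tendsto_dist_iff[of _ "-a"] eq by (subst (asm) tendsto_dist_iff)
qed

text \<open>By the ultrametric inequality a block of terms is no larger than its largest term, so
  null terms already make the partial sums Cauchy.\<close>

lemma summable_nonarch:
  fixes u :: "nat \<Rightarrow> 'a::nonarch_group"
  assumes "u \<longlonglongrightarrow> 0"
  shows "summable u"
proof -
  have "Cauchy (\<lambda>n. \<Sum>i<n. u i)"
  proof (rule metric_CauchyI)
    fix e :: real
    assume e: "0 < e"
    \<comment> \<open>The bound on finite sums is not strict; \<open>e / 2\<close> leaves room for
      the strict one.\<close>
    obtain N where N: "\<And>n. n \<ge> N \<Longrightarrow> dist (u n) 0 < e / 2"
      using metric_LIMSEQ_D[OF assms, of "e / 2"] e by auto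
    have less: "dist (\<Sum>i<m. u i) (\<Sum>i<n. u i) < e" if "N \<le> n" "n \<le> m" for m n
    proof -
      have "dist (\<Sum>i<m. u i) (\<Sum>i<n. u i) = dist (\<Sum>i\<in>{n..<m}. u i) 0"
        using that sum_diff_nat_ivl[of 0 n m u]
        by (subst dist_eq_dist_diff) (simp add: atLeast0LessThan)
      also have "\<dots> \<le> e / 2"
        using that e by (intro dist_sum_0_le less_imp_le[OF N]) auto
      finally show ?thesis using e by simp
    qed
    have "dist (\<Sum>i<m. u i) (\<Sum>i<n. u i) < e" if "N \<le> m" "N \<le> n" for m n
      using less[of m n] less[of n m] that by (cases "n \<le> m") (auto simp: dist_commute)
    then show "\<exists>M. \<forall>m\<ge>M. \<forall>n\<ge>M. dist (\<Sum>i<m. u i) (\<Sum>i<n. u i) < e" by blast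
  qed
  then show ?thesis
    by (auto simp: Cauchy_convergent_iff convergent_def summable_def sums_def)
qed

text \<open>The bound on finite sums survives the limit because it does not grow with the number of
  terms.\<close>

lemma dist_suminf_0_le:
  fixes u :: "nat \<Rightarrow> 'a::nonarch_group"
  assumes "u \<longlonglongrightarrow> 0" "\<And>n. dist (u n) 0 \<le> M"
  shows "dist (\<Sum>n. u n) 0 \<le> M"
proof -
  have "(\<lambda>n. dist (\<Sum>i<n. u i) 0) \<longlonglongrightarrow> dist (\<Sum>n. u n) 0"
    using summable_LIMSEQ[OF summable_nonarch[OF assms(1)]] by (intro tendsto_dist) simp_all
  moreover have "0 \<le> M" using assms(2)[of 0] zero_le_dist order_trans by blast
  ultimately show ?thesis
    by (intro LIMSEQ_le_const2) (auto intro!: dist_sum_0_le assms(2))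
qed

section \<open>The field and the space of null sequences\<close>

instance complete_nonarch_field \<subseteq> nonarch_group
proof
  fix x y :: 'a
  show "dist x y = dist (x - y) 0" by (simp add: dist_val)
  show "dist (x + y) 0 \<le> max (dist x 0) (dist y 0)" by (simp add: dist_val val_add_le_max)
qed

lemma val_0 [simp]: "val (0 :: 'k::complete_nonarch_field) = 0"
  by (simp add: val_eq_0_iff)

lemma val_1 [simp]: "val (1 :: 'k::complete_nonarch_field) = 1"
proof -
  have "val (1 :: 'k) * val (1 :: 'k) = val (1 :: 'k)"
    by (simp flip: val_mult)
  moreover have "val (1 :: 'k) \<noteq> 0" by (simp add: val_eq_0_iff)
  ultimately show ?thesis by (metis mult_cancel_right1)
qed

lemma val_power: "val (x ^ n) = val x ^ n" for x :: "'k::complete_nonarch_field"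
  by (induction n) (simp_all add: val_mult)

lemma val_divide: "val (x / y) = val x / val y" for x y :: "'k::complete_nonarch_field"
proof (cases "y = 0")
  case False
  then have "val (x / y) * val y = val x" by (simp flip: val_mult)
  then show ?thesis using False by (simp add: val_eq_0_iff field_simps)
qed simp

lemma val_minus_commute: "val (x - y) = val (y - x)" for x y :: "'k::complete_nonarch_field"
  by (metis dist_commute dist_val)

lemma val_sum_le:
  fixes u :: "'i \<Rightarrow> 'k::complete_nonarch_field"
  assumes "\<And>i. i \<in> A \<Longrightarrow> val (u i) \<le> M" "0 \<le> M"
  shows "val (\<Sum>i\<in>A. u i) \<le> M"
  using dist_sum_0_le[of A u M] assms by (simp add: dist_val)

lemma val_prod: "val (\<Prod>i\<in>A. u i) = (\<Prod>i\<in>A. val (u i))"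
  for u :: "'i \<Rightarrow> 'k::complete_nonarch_field"
  by (induction A rule: infinite_finite_induct) (simp_all add: val_mult)

text \<open>Rests on \<open>x * y - a * b = (x - a) * y + a * (y - b)\<close>, both parts of which
  vanish in the limit. It yields \<open>tendsto_mult\<close> for the field.\<close>

instance complete_nonarch_field \<subseteq> topological_semigroup_mult
proof
  fix a b :: 'a
  have le: "dist (x * y) (a * b) \<le> dist x a * val y + val a * dist y b" for x y
  proof -
    have "dist (x * y) (a * b) = val ((x - a) * y + a * (y - b))"
      by (simp add: dist_val algebra_simps)
    also have "\<dots> \<le> max (val ((x - a) * y)) (val (a * (y - b)))" by (rule val_add_le_max)
    also have "\<dots> \<le> dist x a * val y + val a * dist y b"
      unfolding dist_val val_mult
      using mult_nonneg_nonneg[OF val_nonneg[of "x - a"] val_nonneg[of y]]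
        mult_nonneg_nonneg[OF val_nonneg[of a] val_nonneg[of "y - b"]] by linarith
    finally show ?thesis .
  qed
  have "((\<lambda>x. dist (fst x) a * val (snd x) + val a * dist (snd x) b) \<longlongrightarrow>
      dist a a * val b + val a * dist b b) (nhds a \<times>\<^sub>F nhds b)"
    unfolding val_eq_dist
    by (intro tendsto_add tendsto_mult tendsto_dist tendsto_const filterlim_fst filterlim_snd)
  then have lim: "((\<lambda>x. dist (fst x) a * val (snd x) + val a * dist (snd x) b) \<longlongrightarrow> 0) (nhds a \<times>\<^sub>F nhds b)"
    by simp
  show "((\<lambda>x. fst x * snd x) \<longlongrightarrow> a * b) (nhds a \<times>\<^sub>F nhds b)"
    unfolding tendsto_dist_iff[of _ "a * b"]
    by (rule tendsto_sandwich[OF _ _ tendsto_const lim]) (simp_all add: le)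
qed

lemma tendsto_val:
  fixes x :: "'i \<Rightarrow> 'k::complete_nonarch_field"
  shows "(x \<longlongrightarrow> a) F \<Longrightarrow> ((\<lambda>n. val (x n)) \<longlongrightarrow> val a) F"
  unfolding val_eq_dist by (intro tendsto_dist tendsto_const)

lemma c0_nth_simps [simp]:
  fixes x y :: "'k::complete_nonarch_field c0"
  shows "c0_nth 0 n = (0 :: 'k)" "c0_nth (x + y) n = c0_nth x n + c0_nth y n"
    "c0_nth (- x) n = - c0_nth x n" "c0_nth (x - y) n = c0_nth x n - c0_nth y n"
    "c0_nth (a *\<^sub>c x) n = a * c0_nth x n"
  unfolding minus_c0_def zero_c0.rep_eq plus_c0.rep_eq uminus_c0.rep_eq scale_c0.rep_eq by simp_all

lemma c0_eqI: "(\<And>n. c0_nth x n = c0_nth y n) \<Longrightarrow> x = y"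
  using c0_nth_inject[of x y] by (blast intro: ext)

lemma c0_nth_tendsto: "c0_nth x \<longlonglongrightarrow> 0"
  using c0_nth[of x] by simp

lemma dist_c0_0: "dist x 0 = norm_c0 x" for x :: "'k::complete_nonarch_field c0"
  by (simp add: dist_c0_def)

lemma norm_c0_0 [simp]: "norm_c0 (0 :: 'k::complete_nonarch_field c0) = 0"
  by (simp add: c0_norm_eq_0_iff)

text \<open>Coordinates are 1-Lipschitz, so a Cauchy sequence converges coordinatewise. The
  convergence is uniform in the coordinate, which makes the limit a null sequence and a limit in
  norm.\<close>

instance c0 :: (complete_nonarch_field) complete_space
proof
  fix X :: "nat \<Rightarrow> 'a c0"
  assume X: "Cauchy X"
  have le: "dist (c0_nth x k) (c0_nth y k) \<le> dist x y" for x y :: "'a c0" and k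
    using c0_val_le_norm[of "x - y" k] by (simp add: dist_val dist_c0_def)
  have "Cauchy (\<lambda>n. c0_nth (X n) k)" for k
  proof (rule metric_CauchyI)
    fix e :: real
    assume "0 < e"
    then obtain N where "\<And>m n. m \<ge> N \<Longrightarrow> n \<ge> N \<Longrightarrow> dist (X m) (X n) < e"
      using metric_CauchyD[OF X] by blast
    then show "\<exists>N. \<forall>m\<ge>N. \<forall>n\<ge>N. dist (c0_nth (X m) k) (c0_nth (X n) k) < e"
      using le_less_trans[OF le] by blast
  qed
  then have "\<exists>z. (\<lambda>n. c0_nth (X n) k) \<longlonglongrightarrow> z" for k
    by (simp add: Cauchy_convergent_iff convergent_def)
  then obtain z where z: "\<And>k. (\<lambda>n. c0_nth (X n) k) \<longlonglongrightarrow> z k" by metis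
  have unif: "\<exists>N. \<forall>n\<ge>N. \<forall>k. dist (c0_nth (X n) k) (z k) \<le> e" if e: "0 < e" for e
  proof -
    obtain N where N: "\<And>m n. m \<ge> N \<Longrightarrow> n \<ge> N \<Longrightarrow> dist (X m) (X n) < e"
      using metric_CauchyD[OF X e] by blast
    have "dist (c0_nth (X n) k) (z k) \<le> e" if "n \<ge> N" for n k
    proof (rule LIMSEQ_le_const2)
      show "(\<lambda>m. dist (c0_nth (X n) k) (c0_nth (X m) k)) \<longlonglongrightarrow> dist (c0_nth (X n) k) (z k)"
        by (intro tendsto_dist tendsto_const z)
      show "\<exists>M. \<forall>m\<ge>M. dist (c0_nth (X n) k) (c0_nth (X m) k) \<le> e"
        using less_imp_le[OF le_less_trans[OF le N[OF that]]] by blast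
    qed
    then show ?thesis by blast
  qed
  have "z \<longlonglongrightarrow> 0"
  proof (rule metric_LIMSEQ_I)
    fix e :: real
    assume e: "0 < e"
    obtain n where n: "\<And>k. dist (c0_nth (X n) k) (z k) \<le> e / 2"
      using unif[of "e / 2"] e by auto
    obtain K where "\<And>k. k \<ge> K \<Longrightarrow> dist (c0_nth (X n) k) 0 < e / 2"
      using metric_LIMSEQ_D[OF c0_nth_tendsto[of "X n"], of "e / 2"] e by auto
    then have "dist (z k) 0 < e" if "k \<ge> K" for k
      using n[of k] dist_triangle3[of "z k" 0 "c0_nth (X n) k"] that by fastforce
    then show "\<exists>K. \<forall>k\<ge>K. dist (z k) 0 < e" by blast
  qed
  then have nth: "c0_nth (Abs_c0 z) = z" by (simp add: Abs_c0_inverse)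
  have "X \<longlonglongrightarrow> Abs_c0 z"
  proof (rule metric_LIMSEQ_I)
    fix e :: real
    assume e: "0 < e"
    obtain N where N: "\<And>n k. n \<ge> N \<Longrightarrow> dist (c0_nth (X n) k) (z k) \<le> e / 2"
      using unif[of "e / 2"] e by auto
    have "dist (X n) (Abs_c0 z) \<le> e / 2" if "n \<ge> N" for n
      unfolding dist_c0_def by (rule c0_norm_leI) (use N[OF that] in \<open>simp add: dist_val nth\<close>)
    then show "\<exists>N. \<forall>n\<ge>N. dist (X n) (Abs_c0 z) < e"
      using e by (intro exI[of _ N]) fastforce
  qed
  then show "convergent X" by (auto simp: convergent_def)
qed

instance c0 :: (complete_nonarch_field) nonarch_group
proof
  fix x y :: "'a c0"
  show "dist x y = dist (x - y) 0" by (simp add: dist_c0_def)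
  show "dist (x + y) 0 \<le> max (dist x 0) (dist y 0)" by (simp add: dist_c0_0 c0_norm_add_le_max)
qed

lemma scale_c0_simps:
  fixes x y :: "'k::complete_nonarch_field c0"
  shows "a *\<^sub>c (x + y) = a *\<^sub>c x + a *\<^sub>c y" "(a + b) *\<^sub>c x = a *\<^sub>c x + b *\<^sub>c x"
    "(a - b) *\<^sub>c x = a *\<^sub>c x - b *\<^sub>c x"
    "a *\<^sub>c b *\<^sub>c x = (a * b) *\<^sub>c x" "1 *\<^sub>c x = x" "0 *\<^sub>c x = 0" "a *\<^sub>c 0 = (0 :: 'k c0)"
  by (auto intro!: c0_eqI simp: algebra_simps)

lemma norm_c0_scale: "norm_c0 (a *\<^sub>c x) = val a * norm_c0 x"
  for x :: "'k::complete_nonarch_field c0"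
proof (cases "a = 0")
  case False
  have le: "norm_c0 (b *\<^sub>c y) \<le> val b * norm_c0 y" for b and y :: "'k c0"
    by (rule c0_norm_leI) (simp add: val_mult mult_left_mono c0_val_le_norm val_nonneg)
  \<comment> \<open>The reverse inequality is the one just shown, applied to the scalar
    \<open>1 / a\<close>.\<close>
  have "x = (1 / a) *\<^sub>c a *\<^sub>c x" using False by (simp add: scale_c0_simps)
  then have "norm_c0 x \<le> val (1 / a) * norm_c0 (a *\<^sub>c x)" using le by metis
  moreover have "val a > 0" using False by (simp add: val_nonneg val_eq_0_iff less_le)
  ultimately have "val a * norm_c0 x \<le> norm_c0 (a *\<^sub>c x)" by (simp add: val_divide field_simps)
  with le show ?thesis by (simp add: antisym)
qed (simp add: scale_c0_simps c0_norm_eq_0_iff)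

lemma tendsto_scale_c0_right:
  fixes x :: "'i \<Rightarrow> 'k::complete_nonarch_field c0"
  assumes "(x \<longlongrightarrow> y) F"
  shows "((\<lambda>n. a *\<^sub>c x n) \<longlongrightarrow> a *\<^sub>c y) F"
proof -
  have "dist (a *\<^sub>c x n) (a *\<^sub>c y) = val a * dist (x n) y" for n
    unfolding dist_c0_def norm_c0_scale[symmetric]
    by (rule arg_cong[where f = norm_c0]) (auto intro!: c0_eqI simp: algebra_simps)
  then show ?thesis
    using assms tendsto_mult[OF tendsto_const[of "val a"], of "\<lambda>n. dist (x n) y" 0]
    by (subst tendsto_dist_iff) (simp add: tendsto_dist_iff[of x])
qed

subsection \<open>The bilinear form\<close>

lemma form_c0_terms_tendsto: "(\<lambda>n. c0_nth x n * c0_nth y n) \<longlonglongrightarrow> 0"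
  using tendsto_mult[OF c0_nth_tendsto c0_nth_tendsto, of x y] by simp

lemma form_c0_add: "form_c0 (x + x') y = form_c0 x y + form_c0 x' y"
  unfolding form_c0_def
  by (simp add: suminf_add summable_nonarch form_c0_terms_tendsto distrib_right)

lemma form_c0_scale: "form_c0 (a *\<^sub>c x) y = a * form_c0 x y"
proof -
  have "(\<lambda>n. \<Sum>i<n. c0_nth x i * c0_nth y i) \<longlonglongrightarrow> form_c0 x y"
    unfolding form_c0_def by (intro summable_LIMSEQ summable_nonarch form_c0_terms_tendsto)
  from tendsto_mult[OF tendsto_const this, of a]
  have "(\<lambda>i. a * c0_nth x i * c0_nth y i) sums (a * form_c0 x y)"
    by (simp add: sums_def sum_distrib_left mult.assoc)
  then show ?thesis by (simp add: form_c0_def sums_iff)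
qed

text \<open>Cauchy-Schwarz for this form: it holds term by term, and the ultrametric bound carries
  it to the sum.\<close>

lemma val_form_c0_le: "val (form_c0 x y) \<le> norm_c0 x * norm_c0 y"
  using dist_suminf_0_le[OF form_c0_terms_tendsto[of x y], of "norm_c0 x * norm_c0 y"]
  by (simp add: form_c0_def dist_val val_mult mult_mono c0_val_le_norm val_nonneg c0_norm_nonneg)

subsection \<open>Formally real residue class fields\<close>

lemma valuation_ring_simps [simp]:
  "carrier valuation_ring = {a :: 'k::complete_nonarch_field. val a \<le> 1}"
  "mult valuation_ring = ((*) :: 'k \<Rightarrow> _)" "one valuation_ring = (1 :: 'k)"
  "zero valuation_ring = (0 :: 'k)" "add valuation_ring = ((+) :: 'k \<Rightarrow> _)"
  by (simp_all add: valuation_ring_def)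

lemma val_add_le: "val x \<le> M \<Longrightarrow> val y \<le> M \<Longrightarrow> val (x + y) \<le> M"
  for x y :: "'k::complete_nonarch_field"
  using val_add_le_max[of x y] by simp

lemma val_diff_le: "val x \<le> M \<Longrightarrow> val y \<le> M \<Longrightarrow> val (x - y) \<le> M"
  for x y :: "'k::complete_nonarch_field"
  using val_add_le[of x M "- y"] by (simp add: val_minus)

lemma val_add_less: "val x < M \<Longrightarrow> val y < M \<Longrightarrow> val (x + y) < M"
  for x y :: "'k::complete_nonarch_field"
  using val_add_le_max[of x y] by simp

lemma cring_valuation_ring: "cring (valuation_ring :: 'k::complete_nonarch_field ring)"
proof (rule cringI)
  show "abelian_group (valuation_ring :: 'k ring)"
  proof (rule abelian_groupI)
    fix x :: 'k
    assume "x \<in> carrier valuation_ring"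
    then show "\<exists>y\<in>carrier valuation_ring. y \<oplus>\<^bsub>valuation_ring\<^esub> x = \<zero>\<^bsub>valuation_ring\<^esub>"
      by (intro bexI[of _ "- x"]) (simp_all add: val_minus)
  qed (simp_all add: val_add_le algebra_simps)
  show "comm_monoid (valuation_ring :: 'k ring)"
    by unfold_locales (simp_all add: val_mult mult_le_one val_nonneg algebra_simps)
qed (simp add: algebra_simps)

lemma ideal_valuation_ring: "ideal {a :: 'k::complete_nonarch_field. val a < 1} valuation_ring"
proof -
  interpret R: cring "valuation_ring :: 'k ring" by (rule cring_valuation_ring)
  have prod: "val (x * y) < 1" if "val x < 1" "val y \<le> 1" for x y :: 'k
    using that mult_left_le[OF that(2) val_nonneg[of x]] by (simp add: val_mult)
  show ?thesis
  proof (rule idealI)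
    show "subgroup {a :: 'k. val a < 1} (add_monoid valuation_ring)"
    proof (rule R.add.subgroupI)
      fix a :: 'k
      assume "a \<in> {a. val a < 1}"
      moreover from this have "\<ominus>\<^bsub>valuation_ring\<^esub> a = - a"
        by (intro R.minus_equality) (simp_all add: val_minus)
      ultimately show "\<ominus>\<^bsub>valuation_ring\<^esub> a \<in> {a. val a < 1}" by (simp add: val_minus)
    qed (auto simp: val_add_less intro: exI[of _ 0])
  next
    fix a x :: 'k
    assume "a \<in> {a. val a < 1}" "x \<in> carrier valuation_ring"
    then show "x \<otimes>\<^bsub>valuation_ring\<^esub> a \<in> {a. val a < 1}" "a \<otimes>\<^bsub>valuation_ring\<^esub> x \<in> {a. val a < 1}"
      using prod[of a x] by (simp_all add: mult.commute)
  qed (rule R.ring_axioms)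
qed

text \<open>Formal reality restated for valuations: modulo the ideal of elements of valuation below
  1 the sum of squares vanishes, so each residue does.\<close>

lemma val_sum_squares_less_1D:
  fixes a :: "nat \<Rightarrow> 'k::complete_nonarch_field"
  assumes real: "formally_real_field (residue_class_field :: 'k set ring)"
    and a: "\<And>i. i < n \<Longrightarrow> val (a i) \<le> 1" and less: "val (\<Sum>i<n. a i * a i) < 1" and "j < n"
  shows "val (a j) < 1"
proof -
  let ?R = "valuation_ring :: 'k ring" and ?I = "{a :: 'k. val a < 1}"
  let ?h = "\<lambda>x. ?I +>\<^bsub>?R\<^esub> x"
  interpret R: cring ?R by (rule cring_valuation_ring)
  interpret I: ideal ?I ?R by (rule ideal_valuation_ring)
  interpret F: formally_real_field "residue_class_field :: 'k set ring" by (rule real)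
  interpret h: ring_hom_cring ?R residue_class_field ?h
    using I.rcos_ring_hom
    by (intro ring_hom_cring.intro ring_hom_cring_axioms.intro R.is_cring F.is_cring) (simp add: residue_class_field_def)
  \<comment> \<open>The zero of the quotient is the ideal itself, so a residue vanishes exactly when
    its representative lies in the ideal.\<close>
  have zero_iff: "?h x = \<zero>\<^bsub>residue_class_field\<^esub> \<longleftrightarrow> val x < 1" if "val x \<le> 1" for x :: 'k
  proof -
    have "\<zero>\<^bsub>residue_class_field\<^esub> = ?I" by (simp add: residue_class_field_def FactRing_def)
    then show ?thesis
      using that I.a_rcos_const[of x] I.a_rcos_self[of x] by auto
  qed
  have sum: "(\<Oplus>\<^bsub>?R\<^esub>i\<in>A. u i) = (\<Sum>i\<in>A. u i)" if "u \<in> A \<rightarrow> carrier ?R" "finite A" for A u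
    using that(2,1) by (induction A) (auto simp: Pi_def)
  have sq: "val (a i * a i) \<le> 1" if "i < n" for i
    using a[OF that] by (simp add: val_mult mult_le_one val_nonneg)
  have "(\<Oplus>\<^bsub>residue_class_field\<^esub>i\<in>{..<n}. ?h (a i) \<otimes>\<^bsub>residue_class_field\<^esub> ?h (a i))
      = (\<Oplus>\<^bsub>residue_class_field\<^esub>i\<in>{..<n}. (?h \<circ> (\<lambda>i. a i * a i)) i)"
    using a sq h.hom_mult by (intro F.add.finprod_cong') (auto intro!: h.hom_closed F.m_closed)
  also have "\<dots> = ?h (\<Oplus>\<^bsub>?R\<^esub>i\<in>{..<n}. a i * a i)"
    using sq by (intro h.hom_finsum[symmetric]) auto
  also have "\<dots> = ?h (\<Sum>i<n. a i * a i)" using sq by (subst sum) auto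
  also have "\<dots> = \<zero>\<^bsub>residue_class_field\<^esub>" using less by (subst zero_iff) auto
  finally have "?h (a j) = \<zero>\<^bsub>residue_class_field\<^esub>"
    using a \<open>j < n\<close> by (intro F.sum_squares_eq_zeroD[of "\<lambda>i. ?h (a i)" n j]) (auto intro!: h.hom_closed)
  then show ?thesis using a \<open>j < n\<close> by (simp add: zero_iff)
qed

text \<open>Suppose the valuation is below 1. Up to a tail of valuation at most 1/2, the form is a
  finite sum of squares, which then also has valuation below 1. Formal reality pushes all
  coordinates of this head below 1, and the norm with them.\<close>

lemma val_form_c0_self:
  fixes y :: "'k::complete_nonarch_field c0"
  assumes real: "formally_real_field (residue_class_field :: 'k set ring)" and y: "norm_c0 y = 1"
  shows "val (form_c0 y y) = 1"
proof (rule antisym)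
  show "val (form_c0 y y) \<le> 1" using val_form_c0_le[of y y] y by simp
  show "1 \<le> val (form_c0 y y)"
  proof (rule ccontr)
    assume "\<not> 1 \<le> val (form_c0 y y)"
    then have less: "val (form_c0 y y) < 1" by simp
    have le1: "val (c0_nth y i) \<le> 1" for i using c0_val_le_norm[of y i] y by simp
    obtain N where N: "\<And>i. i \<ge> N \<Longrightarrow> val (c0_nth y i) < 1 / 2"
      using metric_LIMSEQ_D[OF c0_nth_tendsto[of y], of "1 / 2"] by (auto simp: dist_val)
    let ?u = "\<lambda>i. c0_nth y i * c0_nth y i"
    have u: "val (?u i) \<le> 1 / 2" if "i \<ge> N" for i
      using mult_mono[OF less_imp_le[OF N[OF that]] le1[of i]] by (simp add: val_mult val_nonneg)
    \<comment> \<open>The tail written as a full series with zeros in the head, in the shape that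
      \<open>dist_suminf_0_le\<close> takes.\<close>
    let ?v = "\<lambda>i. if i \<in> {..<N} then 0 else ?u i"
    have v: "?v \<longlonglongrightarrow> 0"
      using form_c0_terms_tendsto[of y y]
      by (rule Lim_transform_eventually)
        (auto simp: eventually_sequentially not_less intro!: exI[of _ N])
    have "dist (\<Sum>i. ?v i) 0 \<le> 1 / 2"
      using v by (rule dist_suminf_0_le) (use u in \<open>auto simp: dist_val\<close>)
    moreover have "?u sums ((\<Sum>i<N. ?u i) + (\<Sum>i. ?v i))"
      using sums_add[OF sums_If_finite_set[of "{..<N}" ?u] summable_sums[OF summable_nonarch[OF v]]]
      by (simp add: if_distrib cong: if_cong)
    then have "(\<Sum>i<N. ?u i) = form_c0 y y + - (\<Sum>i. ?v i)"
      by (simp add: form_c0_def sums_iff)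
    ultimately have "val (\<Sum>i<N. ?u i) < 1"
      using less val_add_less[of "form_c0 y y" 1 "- (\<Sum>i. ?v i)"] by (simp add: dist_val val_minus)
    then have head: "val (c0_nth y i) < 1" if "i < N" for i
      using val_sum_squares_less_1D[OF real, of N "c0_nth y" i] le1 that by simp
    \<comment> \<open>Coordinates that are all below 1 could still have supremum 1; a maximum of
      finitely many values below 1 cannot. The entry \<open>1 / 2\<close> covers the tail.\<close>
    define M where "M = Max (insert (1 / 2) ((\<lambda>i. val (c0_nth y i)) ` {..<N}))"
    have "M < 1" using head unfolding M_def by (subst Max_less_iff) auto
    moreover have "val (c0_nth y i) \<le> M" for i
      using N[of i] unfolding M_def by (cases "i < N") (auto intro: Max_ge simp: Max_ge_iff less_imp_le)
    then have "norm_c0 y \<le> M" by (rule c0_norm_leI)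
    ultimately show False using y by simp
  qed
qed

section \<open>Diagonal operators along an orthonormal sequence\<close>

text \<open>The residue class field acts on what follows only through \<open>val_form_Y\<close>,
  which \<open>val_form_c0_self\<close> supplies.\<close>

locale orthonormal_family =
  fixes Y :: "nat \<Rightarrow> 'k::complete_nonarch_field c0"
  assumes form_orth: "i \<noteq> j \<Longrightarrow> form_c0 (Y i) (Y j) = 0"
    and norm_Y [simp]: "norm_c0 (Y i) = 1"
    and val_form_Y: "val (form_c0 (Y i) (Y i)) = 1"
begin

definition coord :: "nat \<Rightarrow> 'k c0 \<Rightarrow> 'k" where
  "coord i x = form_c0 x (Y i) / form_c0 (Y i) (Y i)"

lemma proj_along_Y: "proj_along (Y i) x = coord i x *\<^sub>c Y i"
  by (simp add: proj_along_def coord_def)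

lemma coord_add: "coord i (x + y) = coord i x + coord i y"
  by (simp add: coord_def form_c0_add add_divide_distrib)

lemma coord_scale: "coord i (a *\<^sub>c x) = a * coord i x"
  by (simp add: coord_def form_c0_scale)

lemma coord_0 [simp]: "coord i 0 = 0"
  using coord_scale[of i 0 0] by (simp add: scale_c0_simps)

lemma coord_diff: "coord i (x - y) = coord i x - coord i y"
  using coord_add[of i "x - y" y] by simp

lemma coord_sum: "coord i (\<Sum>j\<in>A. u j) = (\<Sum>j\<in>A. coord i (u j))"
  by (induction A rule: infinite_finite_induct) (simp_all add: coord_add)

lemma coord_Y: "coord i (Y j) = (if i = j then 1 else 0)"
  using val_form_Y[of i] form_orth[of j i] by (auto simp: coord_def val_eq_0_iff)

lemma val_coord_le: "val (coord i x) \<le> norm_c0 x"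
  using val_form_c0_le[of x "Y i"] by (simp add: coord_def val_divide val_form_Y)

lemma tendsto_coord:
  assumes "(x \<longlongrightarrow> y) F"
  shows "((\<lambda>n. coord i (x n)) \<longlongrightarrow> coord i y) F"
proof -
  have lim: "((\<lambda>n. dist (x n) y) \<longlongrightarrow> 0) F" using assms by (simp add: tendsto_dist_iff[symmetric])
  have "((\<lambda>n. dist (coord i (x n)) (coord i y)) \<longlongrightarrow> 0) F"
    by (rule tendsto_sandwich[OF _ _ tendsto_const lim])
      (simp_all add: dist_val dist_c0_def val_coord_le val_nonneg flip: coord_diff)
  then show ?thesis by (subst tendsto_dist_iff)
qed

text \<open>For \<open>m\<close> tending to \<open>a\<close>, this operator has eigenvalue
  \<open>m i\<close> at \<open>Y i\<close> and acts as \<open>a\<close> on vectors orthogonal to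
  every \<open>Y i\<close>. With eigenvalues as parameters, sums and compositions of operators
  become pointwise sums and products.\<close>

definition diag_map :: "'k \<Rightarrow> (nat \<Rightarrow> 'k) \<Rightarrow> 'k c0 \<Rightarrow> 'k c0" where
  "diag_map a m x = a *\<^sub>c x + (\<Sum>i. (m i - a) *\<^sub>c proj_along (Y i) x)"

lemma diag_map_terms_tendsto:
  assumes "m \<longlonglongrightarrow> a"
  shows "(\<lambda>i. (m i - a) *\<^sub>c proj_along (Y i) x) \<longlonglongrightarrow> 0"
proof -
  have lim: "(\<lambda>i. dist (m i) a * norm_c0 x) \<longlonglongrightarrow> 0"
    using assms tendsto_mult[OF _ tendsto_const, of "\<lambda>i. dist (m i) a" 0 sequentially "norm_c0 x"]
    by (subst (asm) tendsto_dist_iff) simp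
  have "(\<lambda>i. dist ((m i - a) *\<^sub>c proj_along (Y i) x) 0) \<longlonglongrightarrow> 0"
    by (rule tendsto_sandwich[OF _ _ tendsto_const lim])
      (simp_all add: dist_c0_0 norm_c0_scale proj_along_Y dist_val val_coord_le mult_left_mono val_nonneg)
  then show ?thesis by (subst tendsto_dist_iff)
qed

lemma diag_map_sums:
  assumes "m \<longlonglongrightarrow> a"
  shows "(\<lambda>i. (m i - a) *\<^sub>c proj_along (Y i) x) sums (diag_map a m x - a *\<^sub>c x)"
  unfolding diag_map_def
  using summable_sums[OF summable_nonarch[OF diag_map_terms_tendsto[OF assms]]] by simp

text \<open>Uniqueness of sums reduces an identity for \<open>diag_map\<close> to the evaluation of
  one series.\<close>

lemma diag_map_eqI:
  assumes "m \<longlonglongrightarrow> a" "(\<lambda>i. (m i - a) *\<^sub>c proj_along (Y i) x) sums (z - a *\<^sub>c x)"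
  shows "diag_map a m x = z"
  using sums_unique2[OF diag_map_sums[OF assms(1)] assms(2)] by simp

lemma diag_map_add:
  assumes "m \<longlonglongrightarrow> a" "n \<longlonglongrightarrow> b"
  shows "diag_map (a + b) (\<lambda>i. m i + n i) x = diag_map a m x + diag_map b n x"
proof (rule diag_map_eqI)
  show "(\<lambda>i. m i + n i) \<longlonglongrightarrow> a + b" using assms by (rule tendsto_add)
  show "(\<lambda>i. (m i + n i - (a + b)) *\<^sub>c proj_along (Y i) x) sums
      (diag_map a m x + diag_map b n x - (a + b) *\<^sub>c x)"
    using sums_add[OF diag_map_sums[OF assms(1)] diag_map_sums[OF assms(2)], of x x]
    by (simp add: algebra_simps flip: scale_c0_simps(2))
qed

lemma diag_map_const: "diag_map a (\<lambda>i. a) x = a *\<^sub>c x"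
  by (simp add: diag_map_def scale_c0_simps)

text \<open>The coordinate is continuous and passes into the series, where orthogonality leaves the
  term at \<open>j\<close> alone.\<close>

lemma coord_diag_map:
  assumes "m \<longlonglongrightarrow> a"
  shows "coord j (diag_map a m x) = m j * coord j x"
proof -
  let ?u = "\<lambda>i. (m i - a) *\<^sub>c proj_along (Y i) x"
  have "(\<lambda>n. coord j (\<Sum>i<n. ?u i)) \<longlonglongrightarrow> coord j (diag_map a m x - a *\<^sub>c x)"
    using diag_map_sums[OF assms] unfolding sums_def by (rule tendsto_coord)
  moreover have "coord j (\<Sum>i<n. ?u i) = (m j - a) * coord j x" if "j < n" for n
  proof -
    have "coord j (\<Sum>i<n. ?u i) = (\<Sum>i<n. if i = j then (m j - a) * coord j x else 0)"
      unfolding coord_sum by (intro sum.cong) (auto simp: proj_along_Y coord_scale coord_Y)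
    then show ?thesis using that by simp
  qed
  \<comment> \<open>The partial sums are constant once they contain index \<open>j\<close>, that is,
    from \<open>Suc j\<close> on.\<close>
  then have "(\<lambda>n. coord j (\<Sum>i<n. ?u i)) \<longlonglongrightarrow> (m j - a) * coord j x"
    by (intro tendsto_eventually) (auto simp: eventually_sequentially intro!: exI[of _ "Suc j"])
  ultimately have "coord j (diag_map a m x - a *\<^sub>c x) = (m j - a) * coord j x"
    by (rule LIMSEQ_unique)
  then show ?thesis by (simp add: coord_diff coord_scale algebra_simps)
qed

text \<open>Sums the splitting \<open>m i * n i - a * b = a * (n i - b) + (m i - a) * n i\<close>;
  the last factor \<open>n i\<close> comes from projecting \<open>diag_map b n x\<close> onto
  \<open>Y i\<close>.\<close>

lemma diag_map_mult:
  assumes m: "m \<longlonglongrightarrow> a" and n: "n \<longlonglongrightarrow> b"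
  shows "diag_map (a * b) (\<lambda>i. m i * n i) x = diag_map a m (diag_map b n x)"
proof (rule diag_map_eqI)
  show "(\<lambda>i. m i * n i) \<longlonglongrightarrow> a * b" using assms by (rule tendsto_mult)
  have "(\<lambda>i. a *\<^sub>c (n i - b) *\<^sub>c proj_along (Y i) x) sums (a *\<^sub>c (diag_map b n x - b *\<^sub>c x))"
  proof -
    have eq: "(\<Sum>i<k. a *\<^sub>c u i) = a *\<^sub>c (\<Sum>i<k. u i)" for u :: "nat \<Rightarrow> 'k c0" and k
      by (induction k) (simp_all add: scale_c0_simps)
    show ?thesis
      using diag_map_sums[OF n] unfolding sums_def eq by (rule tendsto_scale_c0_right)
  qed
  from sums_add[OF this diag_map_sums[OF m, of "diag_map b n x"]]
  have "(\<lambda>i. a *\<^sub>c (n i - b) *\<^sub>c proj_along (Y i) x + (m i - a) *\<^sub>c proj_along (Y i) (diag_map b n x))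
      sums (a *\<^sub>c (diag_map b n x - b *\<^sub>c x) + (diag_map a m (diag_map b n x) - a *\<^sub>c diag_map b n x))" .
  moreover have "a *\<^sub>c (n i - b) *\<^sub>c proj_along (Y i) x + (m i - a) *\<^sub>c proj_along (Y i) (diag_map b n x)
      = (m i * n i - a * b) *\<^sub>c proj_along (Y i) x" for i
    by (auto intro!: c0_eqI simp: proj_along_Y coord_diag_map[OF n] algebra_simps)
  moreover have "a *\<^sub>c (diag_map b n x - b *\<^sub>c x) + (diag_map a m (diag_map b n x) - a *\<^sub>c diag_map b n x)
      = diag_map a m (diag_map b n x) - (a * b) *\<^sub>c x"
    by (auto intro!: c0_eqI simp: algebra_simps)
  ultimately show "(\<lambda>i. (m i * n i - a * b) *\<^sub>c proj_along (Y i) x) sums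
      (diag_map a m (diag_map b n x) - (a * b) *\<^sub>c x)" by simp
qed

lemma diag_map_scale: "m \<longlonglongrightarrow> a \<Longrightarrow> diag_map (c * a) (\<lambda>i. c * m i) x = c *\<^sub>c diag_map a m x"
  using diag_map_mult[of "\<lambda>_. c" c m a x] by (simp add: diag_map_const)

lemma diag_map_diff:
  assumes "m \<longlonglongrightarrow> a" "n \<longlonglongrightarrow> b"
  shows "diag_map (a - b) (\<lambda>i. m i - n i) x = diag_map a m x - diag_map b n x"
  using diag_map_add[OF tendsto_diff[OF assms] assms(2), of x] by simp

lemma diag_map_Y:
  assumes "m \<longlonglongrightarrow> a"
  shows "diag_map a m (Y j) = m j *\<^sub>c Y j"
proof (rule diag_map_eqI[OF assms])
  have "(\<lambda>i. (m i - a) *\<^sub>c proj_along (Y i) (Y j)) sums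
      (\<Sum>i\<in>{j}. (m i - a) *\<^sub>c proj_along (Y i) (Y j))"
    by (rule sums_finite) (auto simp: proj_along_Y coord_Y scale_c0_simps)
  then show "(\<lambda>i. (m i - a) *\<^sub>c proj_along (Y i) (Y j)) sums (m j *\<^sub>c Y j - a *\<^sub>c Y j)"
    by (simp add: proj_along_Y coord_Y scale_c0_simps)
qed

text \<open>The ultrametric inequality bounds \<open>m i - a\<close> and then the whole sum by the
  same \<open>M\<close>. No constant is lost, which is why the functional calculus is
  isometric.\<close>

lemma norm_diag_map_le:
  assumes "m \<longlonglongrightarrow> a" "val a \<le> M" "\<And>i. val (m i) \<le> M"
  shows "norm_c0 (diag_map a m x) \<le> M * norm_c0 x"
proof -
  have "norm_c0 ((m i - a) *\<^sub>c proj_along (Y i) x) \<le> M * norm_c0 x" for i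
    using mult_mono[OF val_diff_le[OF assms(3,2)] val_coord_le[of i x]] assms(2) val_nonneg[of a]
    by (simp add: norm_c0_scale proj_along_Y val_nonneg)
  then have "norm_c0 (\<Sum>i. (m i - a) *\<^sub>c proj_along (Y i) x) \<le> M * norm_c0 x"
    using dist_suminf_0_le[OF diag_map_terms_tendsto[OF assms(1)]] by (simp add: dist_c0_0)
  moreover have "norm_c0 (a *\<^sub>c x) \<le> M * norm_c0 x"
    using assms(2) by (simp add: norm_c0_scale mult_right_mono c0_norm_nonneg)
  ultimately show ?thesis
    unfolding diag_map_def by (intro order_trans[OF c0_norm_add_le_max]) simp
qed

section \<open>Operator norms of diagonal operators and the metric on \<open>S_alg Y\<close>\<close>

lemma op_norm_le:
  assumes "\<And>x. norm_c0 (T x) \<le> M * norm_c0 x"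
  shows "op_norm (T :: 'k c0 \<Rightarrow> 'k c0) \<le> M"
    and "norm_c0 (T x) \<le> op_norm T * norm_c0 x"
proof -
  have quot: "norm_c0 (T x) / norm_c0 x \<le> M" if "x \<noteq> 0" for x
    using assms[of x] c0_norm_eq_0_iff[of x] c0_norm_nonneg[of x] that
    by (simp add: divide_le_eq)
  then have bdd: "bdd_above ((\<lambda>x. norm_c0 (T x) / norm_c0 x) ` (-{0}))" by (auto intro!: bdd_aboveI2)
  \<comment> \<open>A nonzero vector makes the supremum in \<open>op_norm\<close> range over a
    nonempty set.\<close>
  have "Y 0 \<noteq> 0" using norm_Y[of 0] c0_norm_eq_0_iff[of "Y 0"] by auto
  then have "-{0 :: 'k c0} \<noteq> {}" by blast
  then show "op_norm T \<le> M"
    using bdd quot unfolding op_norm_def by (auto intro!: cSUP_least)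
  show "norm_c0 (T x) \<le> op_norm T * norm_c0 x"
  proof (cases "x = 0")
    case True
    then show ?thesis using assms[of 0] c0_norm_eq_0_iff[of x] by simp
  next
    case False
    then have "norm_c0 (T x) / norm_c0 x \<le> op_norm T"
      using bdd unfolding op_norm_def by (auto intro!: cSUP_upper)
    then show ?thesis
      using False c0_norm_eq_0_iff[of x] c0_norm_nonneg[of x] by (simp add: divide_le_eq)
  qed
qed

lemma op_norm_nonneg: "0 \<le> op_norm (T :: 'k c0 \<Rightarrow> 'k c0)"
proof (cases "bdd_above ((\<lambda>x. norm_c0 (T x) / norm_c0 x) ` (-{0}))")
  case True
  have "Y 0 \<noteq> 0" using norm_Y[of 0] c0_norm_eq_0_iff[of "Y 0"] by auto
  then have "norm_c0 (T (Y 0)) / norm_c0 (Y 0) \<le> op_norm T"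
    using True cSUP_upper[OF _ True, of "Y 0"] by (simp add: op_norm_def)
  then show ?thesis using c0_norm_nonneg[of "T (Y 0)"] by simp
qed (simp add: op_norm_def)

lemma diag_map_bounded:
  assumes "m \<longlonglongrightarrow> a"
  obtains M where "\<And>x. norm_c0 (diag_map a m x) \<le> M * norm_c0 x"
proof -
  have "Bseq (\<lambda>i. val (m i))"
    using tendsto_val[OF assms] by (intro convergent_imp_Bseq) (auto simp: convergent_def)
  then obtain M where "\<forall>i. norm (val (m i)) \<le> M" by (elim BseqE)
  then have "\<And>i. val (m i) \<le> M" by (simp add: val_nonneg)
  then show ?thesis
    using norm_diag_map_le[OF assms, of "max M (val a)"] that by (metis le_max_iff_disj order_refl)
qed

text \<open>Testing on the unit eigenvectors \<open>Y i\<close> bounds each eigenvalue; the bound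
  passes to their limit \<open>a\<close>.\<close>

lemma val_le_op_norm_diag_map:
  assumes "m \<longlonglongrightarrow> a"
  shows "val (m i) \<le> op_norm (diag_map a m)" "val a \<le> op_norm (diag_map a m)"
proof -
  obtain M where M: "\<And>x. norm_c0 (diag_map a m x) \<le> M * norm_c0 x"
    using diag_map_bounded[OF assms] by blast
  show *: "val (m i) \<le> op_norm (diag_map a m)" for i
    using op_norm_le(2)[OF M, of "Y i"] by (simp add: diag_map_Y[OF assms] norm_c0_scale)
  show "val a \<le> op_norm (diag_map a m)"
    using tendsto_val[OF assms] by (rule LIMSEQ_le_const2) (auto intro: *)
qed

lemma op_dist_diag_map:
  assumes "m \<longlonglongrightarrow> a" "n \<longlonglongrightarrow> b"
  shows "op_dist (diag_map a m) (diag_map b n) = op_norm (diag_map (a - b) (\<lambda>i. m i - n i))"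
proof -
  have "(\<lambda>x. diag_map a m x - diag_map b n x) = diag_map (a - b) (\<lambda>i. m i - n i)"
    by (simp add: fun_eq_iff diag_map_diff[OF assms])
  then show ?thesis by (simp add: op_dist_def)
qed

lemma diag_op_eq: "diag_op Y l = diag_map 0 (c0_nth l)"
  by (simp add: fun_eq_iff diag_op_def diag_map_def scale_c0_simps)

lemma S_alg_eq: "S_alg Y = {diag_map a m |a m. m \<longlonglongrightarrow> a}"
proof (intro subset_antisym subsetI)
  fix T
  assume "T \<in> S_alg Y"
  then obtain a l where T: "T = (\<lambda>x. a *\<^sub>c x + diag_op Y l x)" by (auto simp: S_alg_def)
  have "T = diag_map a (\<lambda>i. a + c0_nth l i)" by (simp add: T diag_op_def diag_map_def fun_eq_iff)
  moreover have "(\<lambda>i. a + c0_nth l i) \<longlonglongrightarrow> a"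
    using tendsto_add[OF tendsto_const c0_nth_tendsto[of l], of a] by simp
  ultimately show "T \<in> {diag_map a m |a m. m \<longlonglongrightarrow> a}" by blast
next
  fix T
  assume "T \<in> {diag_map a m |a m. m \<longlonglongrightarrow> a}"
  then obtain a m where m: "m \<longlonglongrightarrow> a" and T: "T = diag_map a m" by blast
  have "(\<lambda>i. m i - a) \<longlonglongrightarrow> 0" using tendsto_diff[OF m tendsto_const[of a]] by simp
  then have "c0_nth (Abs_c0 (\<lambda>i. m i - a)) = (\<lambda>i. m i - a)" by (simp add: Abs_c0_inverse)
  then have "T = (\<lambda>x. a *\<^sub>c x + diag_op Y (Abs_c0 (\<lambda>i. m i - a)) x)"
    by (simp add: T diag_op_def diag_map_def fun_eq_iff)
  then show "T \<in> S_alg Y" by (auto simp: S_alg_def)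
qed

lemma Metric_space_S_alg: "Metric_space (S_alg Y) op_dist"
proof
  fix S T :: "'k c0 \<Rightarrow> 'k c0"
  show "0 \<le> op_dist S T" by (simp add: op_dist_def op_norm_nonneg)
  have "norm_c0 (S x - T x) = norm_c0 (T x - S x)" for x
    using c0_norm_minus[of "S x - T x"] by simp
  then show "op_dist S T = op_dist T S" by (simp add: op_dist_def op_norm_def)
next
  \<comment> \<open>Differences of members of \<open>S_alg Y\<close> are bounded, so the default
    value of \<open>op_norm\<close> does not occur. Definiteness and the triangle inequality follow
    from this estimate.\<close>
  have bound: "norm_c0 (S x - T x) \<le> op_dist S T * norm_c0 x"
    if S: "S \<in> S_alg Y" and T: "T \<in> S_alg Y" for S T x
  proof -
    obtain a m where S': "S = diag_map a m" "m \<longlonglongrightarrow> a" using S by (auto simp: S_alg_eq)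
    obtain b n where T': "T = diag_map b n" "n \<longlonglongrightarrow> b" using T by (auto simp: S_alg_eq)
    obtain M where "\<And>x. norm_c0 (diag_map (a - b) (\<lambda>i. m i - n i) x) \<le> M * norm_c0 x"
      using diag_map_bounded[OF tendsto_diff[OF S'(2) T'(2)]] by blast
    from op_norm_le(2)[OF this] show ?thesis
      by (simp add: S' T' op_dist_diag_map flip: diag_map_diff)
  qed
  {
    fix S T
    assume ST: "S \<in> S_alg Y" "T \<in> S_alg Y"
    show "op_dist S T = 0 \<longleftrightarrow> S = T"
    proof
      assume "op_dist S T = 0"
      then have "norm_c0 (S x - T x) = 0" for x
        using bound[OF ST, of x] c0_norm_nonneg[of "S x - T x"] by simp
      then show "S = T" by (simp add: c0_norm_eq_0_iff fun_eq_iff)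
    next
      assume "S = T"
      then have "op_dist S T \<le> 0"
        unfolding op_dist_def by (intro op_norm_le(1)) simp
      then show "op_dist S T = 0" using op_norm_nonneg by (simp add: op_dist_def antisym)
    qed
    fix R
    assume R: "R \<in> S_alg Y"
    have "norm_c0 (S x - R x) \<le> (op_dist S T + op_dist T R) * norm_c0 x" for x
    proof -
      have "norm_c0 (S x - R x) \<le> norm_c0 (S x - T x) + norm_c0 (T x - R x)"
        using dist_triangle[of "S x" "R x" "T x"] by (simp add: dist_c0_def)
      also have "\<dots> \<le> op_dist S T * norm_c0 x + op_dist T R * norm_c0 x"
        by (intro add_mono bound ST R)
      finally show ?thesis by (simp add: distrib_right)
    qed
    then show "op_dist S R \<le> op_dist S T + op_dist T R"
      unfolding op_dist_def[of S R] by (rule op_norm_le(1))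
  }
qed

end

section \<open>Continuous functions on the spectrum\<close>

lemma zero_in_spec [simp]: "0 \<in> spec l"
  by (simp add: spec_def)

lemma c0_nth_in_spec [simp]: "c0_nth l i \<in> spec l"
  by (simp add: spec_def)

text \<open>A null sequence leaves only finitely many indices with entries this large, and
  \<open>0 < r\<close> excludes the point 0.\<close>

lemma finite_spec_val_ge:
  assumes "0 < r"
  shows "finite {z \<in> spec l. r \<le> val z}"
proof -
  obtain N where N: "\<And>i. i \<ge> N \<Longrightarrow> val (c0_nth l i) < r"
    using metric_LIMSEQ_D[OF c0_nth_tendsto[of l] assms] by (auto simp: dist_val)
  have "i < N" if "r \<le> val (c0_nth l i)" for i
    by (rule ccontr) (use N[of i] that in simp)
  then have "{z \<in> spec l. r \<le> val z} \<subseteq> c0_nth l ` {..<N}"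
    using assms by (auto simp: spec_def)
  then show ?thesis by (rule finite_subset) simp
qed

text \<open>All nonzero points of the spectrum are isolated.\<close>

lemma continuous_on_spec_iff:
  fixes f :: "'k::complete_nonarch_field \<Rightarrow> 'k"
  shows "continuous_on (spec l) f \<longleftrightarrow> (\<lambda>i. f (c0_nth l i)) \<longlonglongrightarrow> f 0"
proof
  assume "continuous_on (spec l) f"
  then show "(\<lambda>i. f (c0_nth l i)) \<longlonglongrightarrow> f 0"
    by (rule continuous_on_tendsto_compose[OF _ c0_nth_tendsto]) simp_all
next
  assume lim: "(\<lambda>i. f (c0_nth l i)) \<longlonglongrightarrow> f 0"
  show "continuous_on (spec l) f"
    unfolding continuous_on_iff
  proof (intro ballI allI impI)
    fix x e
    assume x: "x \<in> spec l" and e: "0 < (e::real)"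
    show "\<exists>d>0. \<forall>z\<in>spec l. dist z x < d \<longrightarrow> dist (f z) (f x) < e"
    proof (cases "x = 0")
      case True
      obtain N where N: "\<And>i. i \<ge> N \<Longrightarrow> dist (f (c0_nth l i)) (f 0) < e"
        using metric_LIMSEQ_D[OF lim e] by blast
      \<comment> \<open>Closer to 0 than \<open>d\<close> lie only 0 itself and entries of index at
        least \<open>N\<close>.\<close>
      obtain d where d: "d > 0" "\<And>z. z \<in> c0_nth l ` {..<N} \<Longrightarrow> z \<noteq> 0 \<Longrightarrow> d \<le> dist 0 z"
        using finite_set_avoid[of "c0_nth l ` {..<N}" 0] by blast
      have "dist (f z) (f 0) < e" if z: "z \<in> spec l" "dist z 0 < d" for z
      proof (cases "z = 0")
        case False
        with z(1) obtain i where i: "z = c0_nth l i" by (auto simp: spec_def)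
        have "N \<le> i" using d(2)[of z] False z(2) i by (auto simp: dist_commute linorder_not_less[symmetric])
        then show ?thesis using N i by simp
      qed (use e in simp)
      then show ?thesis using d(1) True by blast
    next
      case False
      then have pos: "0 < val x / 2" by (simp add: less_le val_nonneg val_eq_0_iff)
      \<comment> \<open>Points within \<open>val x / 2\<close> of \<open>x\<close> belong to the
        finite set avoided here, so a small enough ball around \<open>x\<close> meets the spectrum
        in \<open>x\<close> alone.\<close>
      obtain d where d: "d > 0" "\<And>z. z \<in> {z \<in> spec l. val x / 2 \<le> val z} \<Longrightarrow> z \<noteq> x \<Longrightarrow> d \<le> dist x z"
        using finite_set_avoid[OF finite_spec_val_ge[OF pos], of l x] by blast
      have "z = x" if z: "z \<in> spec l" "dist z x < min d (val x / 2)" for z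
      proof (rule ccontr)
        assume "z \<noteq> x"
        moreover have "val x \<le> dist z x + val z"
          using dist_triangle3[of x 0 z] by (simp add: val_eq_dist)
        then have "val x / 2 \<le> val z" using z(2) by (simp add: min_def split: if_splits)
        ultimately show False using d(2)[of z] z by (simp add: dist_commute)
      qed
      then have "\<forall>z\<in>spec l. dist z x < min d (val x / 2) \<longrightarrow> dist (f z) (f x) < e"
        using e by (metis dist_self)
      then show ?thesis using d(1) pos by (intro exI[of _ "min d (val x / 2)"]) simp
    qed
  qed
qed

section \<open>Continuity and uniform density of polynomials on the spectrum\<close>

lemma continuous_on_spec_power: "continuous_on (spec l) (\<lambda>z. z ^ n)"
  unfolding continuous_on_spec_iff
proof (induction n)
  case (Suc n)
  from tendsto_mult[OF c0_nth_tendsto[of l] this] show ?case by simp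
qed simp

lemma continuous_on_spec_poly: "continuous_on (spec l) (poly p)"
  unfolding continuous_on_spec_iff poly_altdef
  using continuous_on_spec_power[of l]
  by (intro tendsto_sum tendsto_mult tendsto_const) (simp add: continuous_on_spec_iff)

text \<open>
  The factor \<open>(z/c)\<^sup>N\<close> is small for \<open>\<bar>z\<bar> < \<bar>c\<bar>/2\<close>; the finitely many other points are roots.
\<close>

lemma poly_approx_indicator:
  fixes l :: "'k::complete_nonarch_field c0"
  assumes c: "c \<noteq> 0" and e: "0 < e"
  obtains q where "poly q c = 1" "\<And>z. z \<in> spec l \<Longrightarrow> z \<noteq> c \<Longrightarrow> val (poly q z) \<le> e"
proof -
  have pos: "0 < val c / 2" using c by (simp add: less_le val_nonneg val_eq_0_iff)
  define F where "F = {z \<in> spec l. val c / 2 \<le> val z} - {c}"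
  have fin: "finite F" unfolding F_def using finite_spec_val_ge[OF pos] by simp
  \<comment> \<open>Bounds the product of the linear factors at points with
    \<open>val z < val c / 2\<close>, where \<open>val (z - d)\<close> is at most
    \<open>val d\<close>.\<close>
  define B where "B = (\<Prod>d\<in>F. val d / val (c - d))"
  have B: "0 \<le> B" unfolding B_def by (simp add: prod_nonneg val_nonneg)
  obtain N where N: "(1 / 2 :: real) ^ N < e / (1 + B)"
    using real_arch_pow_inv[of "e / (1 + B)" "1 / 2"] e B by auto
  \<comment> \<open>Each linear factor is the Lagrange factor \<open>(z - d) / (c - d)\<close>,
    equal to 1 at \<open>c\<close> and 0 at \<open>d\<close>.\<close>
  define q where "q = [:0, 1 / c:] ^ N * (\<Prod>d\<in>F. [:- d / (c - d), 1 / (c - d):])"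
  have q: "poly q z = (z / c) ^ N * (\<Prod>d\<in>F. (z - d) / (c - d))" for z
    by (simp add: q_def poly_prod diff_divide_distrib)
  show ?thesis
  proof
    have "(\<Prod>d\<in>F. (c - d) / (c - d)) = 1" by (rule prod.neutral) (auto simp: F_def)
    then show "poly q c = 1" using c by (simp add: q)
    fix z
    assume z: "z \<in> spec l" "z \<noteq> c"
    show "val (poly q z) \<le> e"
    proof (cases "z \<in> F")
      case True
      then have "(\<Prod>d\<in>F. (z - d) / (c - d)) = 0" by (intro prod_zero fin) auto
      then show ?thesis using e by (simp add: q)
    next
      case False
      then have less: "val z < val c / 2" using z by (simp add: F_def)
      have "val (z - d) \<le> val d" if "d \<in> F" for d
        using that less by (intro val_diff_le) (auto simp: F_def)
      then have "(\<Prod>d\<in>F. val ((z - d) / (c - d))) \<le> B"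
        unfolding B_def val_divide by (intro prod_mono) (simp add: val_nonneg divide_right_mono)
      moreover have "val ((z / c) ^ N) \<le> (1 / 2) ^ N"
        unfolding val_power val_divide using less pos
        by (intro power_mono) (simp_all add: val_nonneg field_simps)
      ultimately have "val (poly q z) \<le> (1 / 2) ^ N * B"
        unfolding q val_mult val_prod by (intro mult_mono) (simp_all add: val_nonneg prod_nonneg)
      also have "\<dots> \<le> e / (1 + B) * B" using N B by (intro mult_right_mono) simp_all
      also have "\<dots> \<le> e" using e B by (simp add: field_simps)
      finally show ?thesis .
    qed
  qed
qed

text \<open>The constant \<open>f 0\<close> is within \<open>e\<close> of \<open>f\<close> off a
  finite set, and approximate indicators correct its values on that set. Their tolerances make each
  unwanted contribution at most \<open>e\<close>, and the ultrametric inequality keeps the total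
  there however many points there are.\<close>

lemma poly_dense_spec:
  fixes l :: "'k::complete_nonarch_field c0"
  assumes f: "continuous_on (spec l) f" and e: "0 < e"
  obtains p where "\<And>z. z \<in> spec l \<Longrightarrow> val (f z - poly p z) \<le> e"
proof -
  define F where "F = {z \<in> spec l. e \<le> val (f z - f 0)}"
  obtain N where N: "\<And>i. i \<ge> N \<Longrightarrow> val (f (c0_nth l i) - f 0) < e"
    using metric_LIMSEQ_D[OF f[unfolded continuous_on_spec_iff] e] by (auto simp: dist_val)
  have "i < N" if "e \<le> val (f (c0_nth l i) - f 0)" for i
    by (rule ccontr) (use N[of i] that in simp)
  then have "F \<subseteq> c0_nth l ` {..<N}" using e by (auto simp: F_def spec_def)
  then have fin: "finite F" by (rule finite_subset) simp
  have pos: "0 < e / (1 + val (f c - f 0))" for c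
    using e val_nonneg[of "f c - f 0"] by simp
  have "\<exists>q. poly q c = 1 \<and> (\<forall>z\<in>spec l. z \<noteq> c \<longrightarrow> val (poly q z) \<le> e / (1 + val (f c - f 0)))"
    if "c \<in> F" for c
  proof -
    have "c \<noteq> 0" using that e by (auto simp: F_def)
    then show ?thesis using poly_approx_indicator[OF _ pos, of c l c] by metis
  qed
  then obtain q where q1: "\<And>c. c \<in> F \<Longrightarrow> poly (q c) c = 1"
    and q: "\<And>c z. c \<in> F \<Longrightarrow> z \<in> spec l \<Longrightarrow> z \<noteq> c \<Longrightarrow> val (poly (q c) z) \<le> e / (1 + val (f c - f 0))"
    by metis
  define p where "p = [:f 0:] + (\<Sum>c\<in>F. Polynomial.smult (f c - f 0) (q c))"
  have p: "poly p z = f 0 + (\<Sum>c\<in>F. (f c - f 0) * poly (q c) z)" for z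
    by (simp add: p_def poly_sum)
  have term_le: "val ((f c - f 0) * poly (q c) z) \<le> e" if "c \<in> F" "z \<in> spec l" "z \<noteq> c" for c z
  proof -
    have "val ((f c - f 0) * poly (q c) z) \<le> val (f c - f 0) * (e / (1 + val (f c - f 0)))"
      unfolding val_mult by (intro mult_left_mono q that val_nonneg)
    also have "\<dots> \<le> e" using e val_nonneg[of "f c - f 0"] by (simp add: field_simps)
    finally show ?thesis .
  qed
  show ?thesis
  proof
    fix z
    assume z: "z \<in> spec l"
    show "val (f z - poly p z) \<le> e"
    proof (cases "z \<in> F")
      case True
      \<comment> \<open>The indicator at \<open>z\<close> is exactly 1 there, so the term for
        \<open>c = z\<close> cancels \<open>f z - f 0\<close>.\<close>
      have "f z - poly p z = - (\<Sum>c\<in>F - {z}. (f c - f 0) * poly (q c) z)"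
        using True fin by (simp add: p q1 sum.remove)
      moreover have "val (\<Sum>c\<in>F - {z}. (f c - f 0) * poly (q c) z) \<le> e"
        using z e by (intro val_sum_le term_le) auto
      ultimately show ?thesis by (simp add: val_minus)
    next
      case False
      then have "val (f z - f 0) \<le> e" using z by (simp add: F_def)
      moreover have "val (\<Sum>c\<in>F. (f c - f 0) * poly (q c) z) \<le> e"
        using z e False by (intro val_sum_le term_le) auto
      ultimately have "val ((f z - f 0) - (\<Sum>c\<in>F. (f c - f 0) * poly (q c) z)) \<le> e"
        by (rule val_diff_le)
      then show ?thesis by (simp add: p algebra_simps)
    qed
  qed
qed

lemma spec_val_leI:
  assumes "val (f 0) \<le> M" "\<And>i. val (f (c0_nth l i)) \<le> M" "z \<in> spec l"
  shows "val (f z) \<le> M"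
  using assms by (auto simp: spec_def)

section \<open>The functional calculus\<close>

context orthonormal_family
begin

text \<open>Continuity of \<open>f\<close> on the spectrum says exactly that \<open>f 0\<close> is
  the limit of the eigenvalues, the condition under which the laws of \<open>diag_map\<close>
  hold.\<close>

definition fun_op :: "'k c0 \<Rightarrow> ('k \<Rightarrow> 'k) \<Rightarrow> 'k c0 \<Rightarrow> 'k c0" where
  "fun_op l f = diag_map (f 0) (\<lambda>i. f (c0_nth l i))"

lemma fun_op_cong: "(\<And>z. z \<in> spec l \<Longrightarrow> f z = g z) \<Longrightarrow> fun_op l f = fun_op l g"
  by (simp add: fun_op_def)

lemma fun_op_add:
  assumes "continuous_on (spec l) f" "continuous_on (spec l) g"
  shows "fun_op l (\<lambda>z. f z + g z) x = fun_op l f x + fun_op l g x"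
  using assms unfolding fun_op_def continuous_on_spec_iff by (rule diag_map_add)

lemma fun_op_mult:
  assumes "continuous_on (spec l) f" "continuous_on (spec l) g"
  shows "fun_op l (\<lambda>z. f z * g z) x = fun_op l f (fun_op l g x)"
  using assms unfolding fun_op_def continuous_on_spec_iff by (rule diag_map_mult)

lemma fun_op_scale:
  assumes "continuous_on (spec l) f"
  shows "fun_op l (\<lambda>z. a * f z) x = a *\<^sub>c fun_op l f x"
  using assms unfolding fun_op_def continuous_on_spec_iff by (rule diag_map_scale)

lemma fun_op_1: "fun_op l (\<lambda>z. 1) x = x"
  by (simp add: fun_op_def diag_map_const scale_c0_simps)

lemma fun_op_power: "(diag_op Y l ^^ n) x = fun_op l (\<lambda>z. z ^ n) x"
proof (induction n)
  case 0
  then show ?case by (simp add: fun_op_1)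
next
  case (Suc n)
  have "diag_op Y l = fun_op l (\<lambda>z. z)" by (simp add: diag_op_eq fun_op_def)
  then show ?case
    using fun_op_mult[OF continuous_on_id continuous_on_spec_power, of l n x] Suc by simp
qed

lemma poly_op_eq: "poly_op p (diag_op Y l) = fun_op l (poly p)"
proof
  fix x
  \<comment> \<open>Continuity of the partial sum is carried through the induction because
    \<open>fun_op_add\<close> asks for it.\<close>
  have "(\<Sum>m\<le>N. coeff p m *\<^sub>c (diag_op Y l ^^ m) x) = fun_op l (\<lambda>z. \<Sum>m\<le>N. coeff p m * z ^ m) x
      \<and> continuous_on (spec l) (\<lambda>z. \<Sum>m\<le>N. coeff p m * z ^ m)" for N
  proof (induction N)
    case 0
    show ?case by (simp add: fun_op_def diag_map_const)
  next
    case (Suc N)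
    have cont: "continuous_on (spec l) (\<lambda>z. coeff p (Suc N) * z ^ Suc N)"
      using tendsto_mult[OF tendsto_const continuous_on_spec_power[of l "Suc N", unfolded continuous_on_spec_iff]]
      unfolding continuous_on_spec_iff .
    have "continuous_on (spec l) (\<lambda>z. (\<Sum>m\<le>N. coeff p m * z ^ m) + coeff p (Suc N) * z ^ Suc N)"
      using Suc cont by (intro continuous_on_add) auto
    moreover have "fun_op l (\<lambda>z. (\<Sum>m\<le>N. coeff p m * z ^ m) + coeff p (Suc N) * z ^ Suc N) x
        = fun_op l (\<lambda>z. \<Sum>m\<le>N. coeff p m * z ^ m) x + coeff p (Suc N) *\<^sub>c fun_op l (\<lambda>z. z ^ Suc N) x"
      using Suc cont by (subst fun_op_add) (simp_all only: fun_op_scale[OF continuous_on_spec_power])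
    ultimately show ?case using Suc by (simp only: sum.atMost_Suc fun_op_power)
  qed
  then show "poly_op p (diag_op Y l) x = fun_op l (poly p) x"
    by (simp add: poly_op_def poly_altdef[abs_def])
qed

text \<open>The eigenvalues bound the operator norm from below and \<open>norm_diag_map_le\<close>
  bounds it from above. The pointwise bound also shows that \<open>f\<close> is bounded, so that
  \<open>sup_norm\<close> is a true supremum.\<close>

lemma op_norm_fun_op:
  assumes "continuous_on (spec l) f"
  shows "op_norm (fun_op l f) = sup_norm (spec l) f"
    and "z \<in> spec l \<Longrightarrow> val (f z) \<le> op_norm (fun_op l f)"
proof -
  have lim: "(\<lambda>i. f (c0_nth l i)) \<longlonglongrightarrow> f 0" using assms by (simp add: continuous_on_spec_iff)
  show le: "val (f z) \<le> op_norm (fun_op l f)" if "z \<in> spec l" for z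
    unfolding fun_op_def
    by (rule spec_val_leI[where f = f, OF val_le_op_norm_diag_map(2,1)[OF lim] that])
  then have bdd: "bdd_above ((\<lambda>z. val (f z)) ` spec l)" by (auto intro!: bdd_aboveI2)
  have "val (f z) \<le> sup_norm (spec l) f" if "z \<in> spec l" for z
    using cSUP_upper[OF that bdd] bdd by (simp add: sup_norm_def)
  then have "op_norm (fun_op l f) \<le> sup_norm (spec l) f"
    unfolding fun_op_def by (intro op_norm_le(1) norm_diag_map_le[OF lim]) simp_all
  moreover have "spec l \<noteq> {}" using zero_in_spec by blast
  then have "sup_norm (spec l) f \<le> op_norm (fun_op l f)"
    using bdd le by (auto simp: sup_norm_def intro!: cSUP_least)
  ultimately show "op_norm (fun_op l f) = sup_norm (spec l) f" by simp
qed

lemma op_dist_fun_op: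
  assumes "continuous_on (spec l) f" "continuous_on (spec l) g"
  shows "op_dist (fun_op l f) (fun_op l g) = sup_dist (spec l) f g"
proof -
  have "continuous_on (spec l) (\<lambda>z. f z - g z)"
    using tendsto_diff assms unfolding continuous_on_spec_iff by blast
  then have "op_norm (fun_op l (\<lambda>z. f z - g z)) = sup_dist (spec l) f g"
    by (simp add: op_norm_fun_op sup_dist_def)
  then show ?thesis
    using assms unfolding fun_op_def continuous_on_spec_iff by (simp add: op_dist_diag_map)
qed

section \<open>Injectivity and image of the functional calculus\<close>

lemma inj_on_fun_op: "inj_on (fun_op l) (cont_funs (spec l))"
proof (rule inj_onI)
  fix f g
  assume f: "f \<in> cont_funs (spec l)" and g: "g \<in> cont_funs (spec l)" and eq: "fun_op l f = fun_op l g"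
  have flim: "(\<lambda>i. f (c0_nth l i)) \<longlonglongrightarrow> f 0" and glim: "(\<lambda>i. g (c0_nth l i)) \<longlonglongrightarrow> g 0"
    using f g by (simp_all add: cont_funs_def continuous_on_spec_iff)
  have eq_i: "f (c0_nth l i) = g (c0_nth l i)" for i
  proof -
    have "coord i (fun_op l f (Y i)) = f (c0_nth l i)" "coord i (fun_op l g (Y i)) = g (c0_nth l i)"
      using flim glim by (simp_all add: fun_op_def coord_diag_map coord_Y)
    then show ?thesis using eq by simp
  qed
  moreover have "f 0 = g 0" using LIMSEQ_unique[OF flim] glim by (simp add: eq_i)
  ultimately have "f z = g z" if "z \<in> spec l" for z using that by (auto simp: spec_def)
  then show "f = g" using f g by (intro extensionalityI[of f "spec l"]) (auto simp: cont_funs_def)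
qed

lemma fun_op_in_S_alg: "continuous_on (spec l) f \<Longrightarrow> fun_op l f \<in> S_alg Y"
  by (auto simp: S_alg_eq fun_op_def continuous_on_spec_iff)

lemma restrict_cont_funs: "continuous_on (spec l) f \<Longrightarrow> restrict f (spec l) \<in> cont_funs (spec l)"
  by (simp add: cont_funs_def continuous_on_spec_iff)

lemma fun_op_restrict: "fun_op l (restrict f (spec l)) = fun_op l f"
  by (rule fun_op_cong) simp

text \<open>The eigenvalues of a polynomial in the operator depend on the index only through the
  entry of \<open>l\<close>. Uniform approximation preserves this, so the eigenvalues of a limit
  come from a function on the spectrum, continuous because they converge.\<close>

lemma L_alg_subset: "L_alg Y l \<subseteq> fun_op l ` cont_funs (spec l)"
proof
  interpret S: Metric_space "S_alg Y" op_dist by (rule Metric_space_S_alg)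
  fix T
  assume T: "T \<in> L_alg Y l"
  then have "T \<in> S_alg Y" by (simp add: L_alg_def S.metric_closure_of)
  then obtain a m where m: "m \<longlonglongrightarrow> a" and T_eq: "T = diag_map a m" by (auto simp: S_alg_eq)
  have approx: "\<exists>p. (\<forall>i. val (m i - poly p (c0_nth l i)) < e) \<and> val (a - poly p 0) < e" if "0 < e" for e
  proof -
    from T that obtain p where p: "op_dist T (poly_op p (diag_op Y l)) < e"
      by (auto simp: L_alg_def S.metric_closure_of S.in_mball)
    have plim: "(\<lambda>i. poly p (c0_nth l i)) \<longlonglongrightarrow> poly p 0"
      using continuous_on_spec_poly[of l p] by (simp add: continuous_on_spec_iff)
    show ?thesis
      using p val_le_op_norm_diag_map[OF tendsto_diff[OF m plim]]
      by (auto simp: poly_op_eq fun_op_def T_eq op_dist_diag_map[OF m plim] intro: le_less_trans)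
  qed
  have m_eq: "m i = m j" if "c0_nth l i = c0_nth l j" for i j
  proof (rule ccontr)
    assume "m i \<noteq> m j"
    \<comment> \<open>The gap itself serves as tolerance: two eigenvalues strictly closer than the
      gap to one common value contradict the ultrametric inequality.\<close>
    then have "0 < val (m i - m j)" by (simp add: less_le val_nonneg val_eq_0_iff)
    from approx[OF this] obtain p where p: "\<And>k. val (m k - poly p (c0_nth l k)) < val (m i - m j)"
      by blast
    show False
      using val_add_less[OF p[of i] p[of j, unfolded val_minus_commute[of "m j"]]] that by simp
  qed
  have a_eq: "m i = a" if "c0_nth l i = 0" for i
  proof (rule ccontr)
    assume "m i \<noteq> a"
    then have "0 < val (m i - a)" by (simp add: less_le val_nonneg val_eq_0_iff)
    from approx[OF this] obtain p where p: "val (m i - poly p (c0_nth l i)) < val (m i - a)"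
        "val (a - poly p 0) < val (m i - a)"
      by blast
    show False
      using val_add_less[OF p(1) p(2)[unfolded val_minus_commute[of a "poly p 0"]]] that by simp
  qed
  \<comment> \<open>By \<open>m_eq\<close> the chosen index does not matter, and by
    \<open>a_eq\<close> the value at 0 agrees with the eigenvalues at vanishing entries.\<close>
  define f where "f = (\<lambda>z. if z = 0 then a else m (SOME i. c0_nth l i = z))"
  have f: "f 0 = a" "f (c0_nth l i) = m i" for i
  proof -
    have "c0_nth l (SOME j. c0_nth l j = c0_nth l i) = c0_nth l i"
      by (rule someI[where x = i]) simp
    then show "f (c0_nth l i) = m i"
      using m_eq[of "SOME j. c0_nth l j = c0_nth l i" i] a_eq[of i] by (simp add: f_def)
  qed (simp add: f_def)
  then have "T = fun_op l f" by (simp add: T_eq fun_op_def)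
  moreover have "continuous_on (spec l) f" using m by (simp add: continuous_on_spec_iff f)
  ultimately show "T \<in> fun_op l ` cont_funs (spec l)"
    by (auto simp: fun_op_restrict intro!: image_eqI[of _ _ "restrict f (spec l)"] restrict_cont_funs)
qed

text \<open>For the remaining inclusion, uniform approximation by polynomials on the spectrum
  becomes approximation in operator norm.\<close>

lemma L_alg_eq: "L_alg Y l = fun_op l ` cont_funs (spec l)"
proof (rule subset_antisym[OF L_alg_subset], rule image_subsetI)
  interpret S: Metric_space "S_alg Y" op_dist by (rule Metric_space_S_alg)
  fix f
  assume "f \<in> cont_funs (spec l)"
  then have f: "continuous_on (spec l) f" by (simp add: cont_funs_def)
  have "\<exists>p. op_dist (fun_op l f) (fun_op l (poly p)) < e" if e: "0 < e" for e
  proof -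
    obtain p where p: "\<And>z. z \<in> spec l \<Longrightarrow> val (f z - poly p z) \<le> e / 2"
      using poly_dense_spec[OF f half_gt_zero[OF e]] by blast
    have lim: "(\<lambda>i. f (c0_nth l i)) \<longlonglongrightarrow> f 0" "(\<lambda>i. poly p (c0_nth l i)) \<longlonglongrightarrow> poly p 0"
      using f continuous_on_spec_poly[of l p] by (simp_all add: continuous_on_spec_iff)
    have "op_dist (fun_op l f) (fun_op l (poly p)) \<le> e / 2"
      unfolding fun_op_def op_dist_diag_map[OF lim]
      by (intro op_norm_le(1) norm_diag_map_le tendsto_diff lim p) simp_all
    then show ?thesis using e by (intro exI[of _ p]) simp
  qed
  then show "fun_op l f \<in> L_alg Y l"
    using f by (auto simp: L_alg_def S.metric_closure_of poly_op_eq fun_op_in_S_alg continuous_on_spec_poly)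
qed

text \<open>Definiteness and the triangle inequality are pulled back along the isometric injection
  \<open>fun_op l\<close>. Non-negativity and symmetry concern arbitrary functions and are shown
  directly.\<close>

lemma Metric_space_cont_funs: "Metric_space (cont_funs (spec l)) (sup_dist (spec l))"
  for l :: "'k c0"
proof -
  interpret S: Metric_space "S_alg Y" op_dist by (rule Metric_space_S_alg)
  have S: "fun_op l f \<in> S_alg Y" if "f \<in> cont_funs (spec l)" for f
    using that by (intro fun_op_in_S_alg) (simp add: cont_funs_def)
  have dist: "sup_dist (spec l) f g = op_dist (fun_op l f) (fun_op l g)"
    if "f \<in> cont_funs (spec l)" "g \<in> cont_funs (spec l)" for f g
    using that op_dist_fun_op[of l f g] by (simp add: cont_funs_def)
  show ?thesis
  proof
    fix f g :: "'k \<Rightarrow> 'k"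
    show "0 \<le> sup_dist (spec l) f g"
    proof (cases "bdd_above ((\<lambda>z. val (f z - g z)) ` spec l)")
      case True
      have "0 \<le> val (f 0 - g 0)" by (rule val_nonneg)
      also have "\<dots> \<le> (SUP z\<in>spec l. val (f z - g z))"
        using zero_in_spec True by (rule cSUP_upper)
      finally show ?thesis using True by (simp add: sup_dist_def sup_norm_def)
    qed (simp add: sup_dist_def sup_norm_def)
    have "(\<lambda>z. val (f z - g z)) = (\<lambda>z. val (g z - f z))"
      by (rule ext) (rule val_minus_commute)
    then show "sup_dist (spec l) f g = sup_dist (spec l) g f"
      by (simp only: sup_dist_def sup_norm_def)
  next
    fix f g
    assume fg: "f \<in> cont_funs (spec l)" "g \<in> cont_funs (spec l)"
    have "sup_dist (spec l) f g = 0 \<longleftrightarrow> fun_op l f = fun_op l g"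
      using S.zero[OF S S, OF fg] by (simp only: dist[OF fg])
    then show "sup_dist (spec l) f g = 0 \<longleftrightarrow> f = g"
      using inj_on_eq_iff[OF inj_on_fun_op fg] by simp
  next
    fix f g h
    assume "f \<in> cont_funs (spec l)" "g \<in> cont_funs (spec l)" "h \<in> cont_funs (spec l)"
    then show "sup_dist (spec l) f h \<le> sup_dist (spec l) f g + sup_dist (spec l) g h"
      using S.triangle[OF S S S] by (simp only: dist)
  qed
qed

section \<open>The Gelfand transformation as inverse of the functional calculus\<close>

definition gelfand_map :: "'k c0 \<Rightarrow> ('k c0 \<Rightarrow> 'k c0) \<Rightarrow> 'k \<Rightarrow> 'k" where
  "gelfand_map l = restrict (inv_into (cont_funs (spec l)) (fun_op l)) (L_alg Y l)"

lemma gelfand_map_fun_op: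
  assumes "continuous_on (spec l) f"
  shows "gelfand_map l (fun_op l f) = restrict f (spec l)"
proof -
  have "fun_op l (restrict f (spec l)) \<in> L_alg Y l"
    unfolding L_alg_eq by (intro imageI restrict_cont_funs assms)
  then have "gelfand_map l (fun_op l (restrict f (spec l))) = restrict f (spec l)"
    by (simp only: gelfand_map_def restrict_apply' inv_into_f_f[OF inj_on_fun_op restrict_cont_funs[OF assms]])
  then show ?thesis by (simp only: fun_op_restrict)
qed

lemma L_algE:
  assumes "T \<in> L_alg Y l"
  obtains f where "f \<in> extensional (spec l)" "continuous_on (spec l) f" "T = fun_op l f"
    "gelfand_map l T = f"
proof -
  from assms obtain f where f: "f \<in> extensional (spec l)" "continuous_on (spec l) f" "T = fun_op l f"
    by (auto simp: L_alg_eq cont_funs_def)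
  then show ?thesis using that by (simp add: gelfand_map_fun_op extensional_restrict)
qed

lemma fun_op_in_L_alg: "continuous_on (spec l) f \<Longrightarrow> fun_op l f \<in> L_alg Y l"
  using restrict_cont_funs[of l f] by (subst fun_op_restrict[symmetric]) (auto simp: L_alg_eq)

lemma L_alg_subset_S_alg: "L_alg Y l \<subseteq> S_alg Y"
  by (auto elim!: L_algE simp: fun_op_in_S_alg)

lemma Metric_space_L_alg: "Metric_space (L_alg Y l) op_dist"
  using Metric_space.subspace[OF Metric_space_S_alg L_alg_subset_S_alg] .

lemma gelfand_transformation_gelfand_map: "gelfand_transformation Y l (gelfand_map l)"
proof -
  have "continuous_map (Metric_space.mtopology (L_alg Y l) op_dist)
      (Metric_space.mtopology (cont_funs (spec l)) (sup_dist (spec l))) (gelfand_map l)"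
    unfolding Metric_space.metric_continuous_map[OF Metric_space_L_alg Metric_space_cont_funs]
  proof (intro conjI ballI allI impI image_subsetI)
    fix T
    assume "T \<in> L_alg Y l"
    then show "gelfand_map l T \<in> cont_funs (spec l)" by (elim L_algE) (simp add: cont_funs_def)
  next
    fix T and e :: real
    assume "T \<in> L_alg Y l" "0 < e"
    then show "\<exists>d>0. \<forall>S. S \<in> L_alg Y l \<and> op_dist T S < d \<longrightarrow>
        sup_dist (spec l) (gelfand_map l T) (gelfand_map l S) < e"
      \<comment> \<open>\<open>gelfand_map l\<close> preserves distances, so \<open>e\<close> itself
        serves as \<open>d\<close>.\<close>
      by (intro exI[of _ e]) (auto elim!: L_algE simp: op_dist_fun_op)
  qed
  moreover have "gelfand_map l \<in> extensional (L_alg Y l)" by (simp add: gelfand_map_def)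
  ultimately show ?thesis
    by (simp add: gelfand_transformation_def poly_op_eq gelfand_map_fun_op continuous_on_spec_poly)
qed

text \<open>Continuous maps into a Hausdorff space that agree on the dense set of polynomials in the
  operator are equal.\<close>

lemma gelfand_transformation_unique:
  assumes G: "gelfand_transformation Y l G" and H: "gelfand_transformation Y l H"
  shows "G = H"
proof (rule extensionalityI)
  show "G \<in> extensional (L_alg Y l)" "H \<in> extensional (L_alg Y l)"
    using G H by (simp_all add: gelfand_transformation_def)
  interpret S: Submetric "S_alg Y" op_dist "L_alg Y l"
    by (intro Submetric.intro Metric_space_S_alg Submetric_axioms.intro L_alg_subset_S_alg)
  fix T
  assume T: "T \<in> L_alg Y l"
  let ?P = "range (\<lambda>p. poly_op p (diag_op Y l))"
  have "?P \<subseteq> L_alg Y l" by (auto simp: poly_op_eq intro!: fun_op_in_L_alg continuous_on_spec_poly)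
  \<comment> \<open>The closure defining \<open>L_alg Y l\<close> is taken in
    \<open>S_alg Y\<close>, but continuity refers to the metric on \<open>L_alg Y l\<close>; density
    is therefore transferred to the subspace.\<close>
  then have "S.sub.mtopology closure_of ?P = L_alg Y l \<inter> S.mtopology closure_of ?P"
    unfolding S.mtopology_submetric by (simp add: closure_of_subtopology Int_absorb1)
  then have "T \<in> S.sub.mtopology closure_of ?P" using T by (simp add: L_alg_def)
  then show "G T = H T"
    using G H Metric_space.Hausdorff_space_mtopology[OF Metric_space_cont_funs[of l]]
    by (elim forall_in_closure_of_eq) (auto simp: gelfand_transformation_def)
qed

text \<open>Each operation on operators is rewritten as \<open>fun_op l\<close> of the pointwise
  operation, which \<open>gelfand_map l\<close> then inverts.\<close>

lemma gelfand_map_algebra_iso: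
  "gelfand_map l \<in> algebra_iso (op_algebra (L_alg Y l)) (cont_algebra (spec l))"
proof -
  have cont_mult: "continuous_on (spec l) (\<lambda>z. f z * g z)"
    if "continuous_on (spec l) f" "continuous_on (spec l) g" for f g :: "'k \<Rightarrow> 'k"
    using that unfolding continuous_on_spec_iff by (rule tendsto_mult)
  have mult: "gelfand_map l (S \<circ> T) = (\<lambda>z\<in>spec l. gelfand_map l S z * gelfand_map l T z)"
    and add: "gelfand_map l (\<lambda>x. S x + T x) = (\<lambda>z\<in>spec l. gelfand_map l S z + gelfand_map l T z)"
    if "S \<in> L_alg Y l" "T \<in> L_alg Y l" for S T
  proof -
    obtain f where f: "continuous_on (spec l) f" "S = fun_op l f" "gelfand_map l S = f"
      using L_algE[OF \<open>S \<in> L_alg Y l\<close>] by blast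
    obtain g where g: "continuous_on (spec l) g" "T = fun_op l g" "gelfand_map l T = g"
      using L_algE[OF \<open>T \<in> L_alg Y l\<close>] by blast
    have "S \<circ> T = fun_op l (\<lambda>z. f z * g z)"
      using f g by (simp add: fun_eq_iff fun_op_mult)
    then show "gelfand_map l (S \<circ> T) = (\<lambda>z\<in>spec l. gelfand_map l S z * gelfand_map l T z)"
      using f(1,3) g(1,3) gelfand_map_fun_op[OF cont_mult] by simp
    have "(\<lambda>x. S x + T x) = fun_op l (\<lambda>z. f z + g z)"
      using f g by (simp add: fun_eq_iff fun_op_add)
    then show "gelfand_map l (\<lambda>x. S x + T x) = (\<lambda>z\<in>spec l. gelfand_map l S z + gelfand_map l T z)"
      using f(1,3) g(1,3) gelfand_map_fun_op[OF continuous_on_add] by simp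
  qed
  have scale: "gelfand_map l (\<lambda>x. a *\<^sub>c T x) = (\<lambda>z\<in>spec l. a * gelfand_map l T z)"
    if T: "T \<in> L_alg Y l" for a T
  proof -
    obtain f where f: "continuous_on (spec l) f" "T = fun_op l f" "gelfand_map l T = f"
      using L_algE[OF T] by blast
    have "(\<lambda>x. a *\<^sub>c T x) = fun_op l (\<lambda>z. a * f z)"
      using f by (simp add: fun_eq_iff fun_op_scale)
    then show ?thesis
      using f(1,3) gelfand_map_fun_op[OF cont_mult[OF continuous_on_const]] by simp
  qed
  have one: "gelfand_map l id = (\<lambda>z\<in>spec l. 1)"
  proof -
    have "id = fun_op l (\<lambda>z. 1)" by (simp add: fun_eq_iff fun_op_1)
    then show ?thesis using gelfand_map_fun_op[OF continuous_on_const, of l 1] by simp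
  qed
  have "bij_betw (inv_into (cont_funs (spec l)) (fun_op l)) (L_alg Y l) (cont_funs (spec l))"
    unfolding L_alg_eq by (intro bij_betw_inv_into inj_on_imp_bij_betw inj_on_fun_op)
  then have "bij_betw (gelfand_map l) (L_alg Y l) (cont_funs (spec l))"
    by (rule bij_betw_cong[THEN iffD1, rotated]) (simp add: gelfand_map_def)
  then have "gelfand_map l \<in> ring_iso (op_algebra (L_alg Y l)) (cont_algebra (spec l))"
    unfolding ring_iso_def
    by (auto simp: op_algebra_def cont_algebra_def mult add one
        intro!: ring_hom_memI dest: bij_betw_apply)
  then show ?thesis
    by (simp add: algebra_iso_def op_algebra_def cont_algebra_def scale)
qed

end

theorem proposition3p6:
  fixes Y :: "nat \<Rightarrow> 'k::complete_nonarch_field c0"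
    and l :: "'k c0"
  assumes "formally_real_field (residue_class_field :: 'k set ring)"
    and "orthonormal_seq Y"
    and "infinite (range (c0_nth l))"
  shows "(\<exists>!G. gelfand_transformation Y l G) \<and>
    (\<forall>G. gelfand_transformation Y l G \<longrightarrow>
       G \<in> algebra_iso (op_algebra (L_alg Y l)) (cont_algebra (spec l)) \<and>
       (\<forall>T\<in>L_alg Y l. sup_norm (spec l) (G T) = op_norm T))"
proof -
  interpret orthonormal_family Y
    using assms(2) val_form_c0_self[OF assms(1)] by unfold_locales (auto simp: orthonormal_seq_def)
  \<comment> \<open>Existence and uniqueness together reduce every claim about \<open>G\<close> to
    \<open>gelfand_map l\<close>.\<close>
  have G: "gelfand_transformation Y l G \<longleftrightarrow> G = gelfand_map l" for G
    using gelfand_transformation_gelfand_map gelfand_transformation_unique by blast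
  have "sup_norm (spec l) (gelfand_map l T) = op_norm T" if "T \<in> L_alg Y l" for T
    using that by (elim L_algE) (simp add: op_norm_fun_op)
  then show ?thesis by (simp add: G gelfand_map_algebra_iso)
qed

end
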